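(* Let $\varphi:\mathcal{U}\subseteq\mathbb{R}^n\to\mathbb{R}$ be twice continuously differentiable on the open set $\mathcal{U}$ and suppose $\varphi$ can be written as a codelist. Let $\mathcal{B}=[\underline{x}_1,\overline{x}_1]\times\cdots\times[\underline{x}_n,\overline{x}_n]\subset\mathcal{U}$ be an arbitrary closed hyperrectangle. Let $[\lambda_\varphi^{D}]$ and $[\lambda_\varphi^{S}]$ denote the eigenvalue bounds for $\nabla^2\varphi(x)$ on $\mathcal{B}$ computed by the direct (non-sparse) Algorithm D and by the sparse Algorithm S, respectively (both described in the context). Then $$[\lambda_\varphi^{S}]\subseteq[\lambda_\varphi^{D}].$$
   Context: **Notation.** $\mathcal{N}=\{1,\dots,n\}$; for $\mathcal{J}\subseteq\mathcal{N}$, $\mathcal{J}^c=\mathcal{N}\setminus\mathcal{J}$ and $|\mathcal{J}|$ is the cardinality. $\subsetneq$ is strict inclusion. $e_k$ is the $k$-th unit vector. $[a]=[\underline{a},\overline{a}]$ denotes a real interval, or a hyperrectangle $[\underline{a}_1,\overline{a}_1]\times\cdots\times[\underline{a}_m,\overline{a}_m]$. For a hyperrectangle $[\nabla y]\subset\mathbb{R}^n$ and nonempty $\mathcal{J}=\{j_1<\dots<j_m\}\subseteq\mathcal{N}$, $[\nabla_{\mathcal{J}}y]\subset\mathbb{R}^m$ is the hyperrectangle of the components $j_1,\dots,j_m$. **Interval arithmetic.** $[a]+[b]=[\underline a+\underline b,\overline a+\overline b]$; $[a][b]=[\min P,\max P]$ with $P=\{\underline a\,\underline b,\underline a\,\overline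 b,\overline a\,\underline b,\overline a\,\overline b\}$; $1/[a]=[1/\overline a,1/\underline a]$ (requires $0\notin[a]$); $[a]^0=[1,1]$ and, for $m\ge1$, $[a]^m=[\underline a^m,\overline a^m]$ if $\underline a>0$ or $m$ odd, $[\overline a^m,\underline a^m]$ if $\overline a<0$ and $m$ even, $[0,\max\{\underline a^m,\overline a^m\}]$ otherwise; $\sqrt{[a]}=[\sqrt{\underline a},\sqrt{\overline a}]$ (requires $\underline a\ge0$); $\exp([a])=[\exp\underline a,\exp\overline a]$; $\ln([a])=[\ln\underline a,\ln\overline a]$ (requires $\underline a>0$); $[a]+c=[\underline a+c,\overline a+c]$; $c[a]=[c\underline a,c\overline a]$ if $c\ge0$, $[c\overline a,c\underline a]$ otherwise; $-[a]=(-1)[a]$, $[a]-[b]=[a]+(-1)[b]$. For hyperrectangles, operations (including multiplication by an interval) are componentwise. All interval operations used are assumed to be well defined (the stated restrictions hold). **Interval operators.** For hyperrectangles $[a],[b]\subset\mathbb{R}^m$: $[\Lambda_s([a])]=[a]^2$ if $m=1$, and $[0,\sum_{i=1}^m\max\{\underline a_i^2,\overline a_i^2\}]$ otherwise; $[\Lambda_t([a],[b])]=2[a][b]$ if $m=1$, and $[-\beta,\beta]+\sum_{i=1}^m[a_i][b_i]$ otherwise, where $\beta=\sqrt{(\sum_i\max\{\underline a_i^2,\overline a_i^2\})(\sum_i\max\{\underline b_i^2,\overline b_i^2\})}$. For real intervals: $[\Lambda_r([a],[b])]=[\min\{\underline a,\underline b\},\max\{\overline a,\overline b\}]$ and $[\Lambda_\star([a],[b],[c])]=\frac12\big[\underline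 a+\underline b-\sqrt{(\underline a-\underline b)^2+d},\ \overline a+\overline b+\sqrt{(\overline a-\overline b)^2+d}\big]$ with $d=4\max\{\underline c^2,\overline c^2\}$. **Codelist.** $\varphi$ can be written as a codelist with $t$ operations if on $\mathcal{U}$: $y_k=x_k$ for $k=1,\dots,n$; for $k=n+1,\dots,n+t$, $y_k$ is obtained from earlier $y_i$ (and $y_j$), $i,j<k$, by one of the operations: add $y_k=y_i+y_j$; mul $y_k=y_iy_j$; powNat $y_k=y_i^m$ ($m\ge2$ natural); oneOver $y_k=1/y_i$; sqrt $y_k=\sqrt{y_i}$; exp $y_k=\exp(y_i)$; ln $y_k=\ln(y_i)$; addC $y_k=y_i+c$; mulByC $y_k=c\,y_i$ ($c\in\mathbb{R}$ constant); and $\varphi=y_{n+t}$. Both algorithms are applied to the same codelist. **Values and gradients (common to both algorithms).** For $k=1,\dots,n$: $[y_k]=[\underline x_k,\overline x_k]$, $[\nabla y_k]=[e_k,e_k]$. For $k=n+1,\dots,n+t$, $[y_k]$ and $[\nabla y_k]$ are: add: $[y_i]+[y_j]$, $[\nabla y_i]+[\nabla y_j]$; mul: $[y_i][y_j]$, $[y_j][\nabla y_i]+[y_i][\nabla y_j]$; powNat: $[y_i]^m$, $m[y_i]^{m-1}[\nabla y_i]$; oneOver: $1/[y_i]$, $-[y_k]^2[\nabla y_i]$; sqrt: $\sqrt{[y_i]}$, $(1/(2[y_k]))[\nabla y_i]$; exp: $\exp([y_i])$, $[y_k][\nabla y_i]$; ln: $\ln([y_i])$, $(1/[y_i])[\nabla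 y_i]$; addC: $[y_i]+c$, $[\nabla y_i]$; mulByC: $c[y_i]$, $c[\nabla y_i]$. **Algorithm D.** $[\lambda_k]=[0,0]$ for $k=1,\dots,n$. For $k=n+1,\dots,n+t$, with $[\Lambda_s]$ short for $[\Lambda_s([\nabla y_i])]$, $[\lambda_k]$ is: add $[\lambda_i]+[\lambda_j]$; mul $[y_j][\lambda_i]+[y_i][\lambda_j]+[\Lambda_t([\nabla y_i],[\nabla y_j])]$; powNat $m[y_i]^{m-2}((m-1)[\Lambda_s]+[y_i][\lambda_i])$; oneOver $[y_k]^2(2[y_k][\Lambda_s]-[\lambda_i])$; sqrt $(1/(2[y_k]))([\lambda_i]+(1/(-2[y_i]))[\Lambda_s])$; exp $[y_k]([\Lambda_s]+[\lambda_i])$; ln $(1/[y_i])([\lambda_i]-(1/[y_i])[\Lambda_s])$; addC $[\lambda_i]$; mulByC $c[\lambda_i]$. Output $[\lambda_\varphi^D]=[\lambda_{n+t}]$. **Algorithm S.** *Step 1.* For $k=1,\dots,n$: $\mathcal{I}_k=\mathcal{N}\setminus\{k\}$, $\mathcal{L}_k=\mathcal{N}$, $[\lambda_k^\dagger]=[0,0]$. *Step 2.* For $k=n+1,\dots,n+t$: (a) Index sets: add: $\mathcal{I}_k=\mathcal{I}_i\cap\mathcal{I}_j$, $\mathcal{L}_k=\mathcal{L}_i\cap\mathcal{L}_j$; mul: $\mathcal{I}_k=\mathcal{L}_k=\mathcal{I}_i\cap\mathcal{I}_j$; powNat, oneOver, sqrt, exp, ln: $\mathcal{I}_k=\mathcal{L}_k=\mathcal{I}_i$;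 addC, mulByC: $\mathcal{I}_k=\mathcal{I}_i$, $\mathcal{L}_k=\mathcal{L}_i$. (b) $[\lambda_k^\dagger]$, with $[\lambda_{i,0}]=[\min\{\underline\lambda_i^\dagger,0\},\max\{\overline\lambda_i^\dagger,0\}]$, likewise $[\lambda_{j,0}]$; $\mathcal{L}_\cup=\mathcal{L}_i\cup\mathcal{L}_j$, $\mathcal{L}_\cap=\mathcal{L}_i\cap\mathcal{L}_j$; $[\lambda_t]=[\Lambda_t([\nabla_{\mathcal{L}_k^c}y_i],[\nabla_{\mathcal{L}_k^c}y_j])]$; $[\Lambda_s^k]$ short for $[\Lambda_s([\nabla_{\mathcal{L}_k^c}y_i])]$; $[\gamma]=[\nabla_{\mathcal{I}_i^c}y_i][\nabla_{\mathcal{I}_j^c}y_j]$; condition $C_\star$: $\mathcal{I}_i\cup\mathcal{I}_j=\mathcal{N}$ and $|\mathcal{I}_i|=|\mathcal{I}_j|=n-1$. add: - $[0,0]$ if $\mathcal{L}_i=\mathcal{L}_j=\mathcal{N}$; - $[\lambda_i^\dagger]$ if $\mathcal{L}_i\subsetneq\mathcal{N}=\mathcal{L}_j$; - $[\lambda_j^\dagger]$ if $\mathcal{L}_j\subsetneq\mathcal{N}=\mathcal{L}_i$; - $[\Lambda_r([\lambda_i^\dagger],[\lambda_j^\dagger])]$ if $\mathcal{L}_i,\mathcal{L}_j\subsetneq\mathcal{N}$, $\mathcal{L}_\cup=\mathcal{N}$; - and if $\mathcal{L}_\cup\subsetneq\mathcal{N}$: $[\lambda_i^\dagger]+[\lambda_j^\dagger]$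 if $\mathcal{L}_i=\mathcal{L}_j$; $[\lambda_i^\dagger]+[\lambda_{j,0}]$ if $\mathcal{L}_i\subsetneq\mathcal{L}_j$; $[\lambda_{i,0}]+[\lambda_j^\dagger]$ if $\mathcal{L}_j\subsetneq\mathcal{L}_i$; $[\lambda_{i,0}]+[\lambda_{j,0}]$ if $\mathcal{L}_i\nsubseteq\mathcal{L}_j$ and $\mathcal{L}_j\nsubseteq\mathcal{L}_i$. mul: - $[\lambda_t]$ if $\mathcal{L}_i=\mathcal{L}_j=\mathcal{N}$; - if $\mathcal{L}_i\subsetneq\mathcal{N}=\mathcal{L}_j$: $[\lambda_t]+[y_j][\lambda_i^\dagger]$ if $\mathcal{L}_k=\mathcal{L}_i$; $[\lambda_t]+[y_j][\lambda_{i,0}]$ if $\mathcal{L}_k\subsetneq\mathcal{L}_i$ and not $C_\star$; $[\Lambda_\star([y_j][\lambda_i^\dagger],[0,0],[\gamma])]$ if $C_\star$; - if $\mathcal{L}_j\subsetneq\mathcal{N}=\mathcal{L}_i$: $[\lambda_t]+[y_i][\lambda_j^\dagger]$ if $\mathcal{L}_k=\mathcal{L}_j$; $[\lambda_t]+[y_i][\lambda_{j,0}]$ if $\mathcal{L}_k\subsetneq\mathcal{L}_j$ and not $C_\star$; $[\Lambda_\star([0,0],[y_i][\lambda_j^\dagger],[\gamma])]$ if $C_\star$; - if $\mathcal{L}_i,\mathcal{L}_j\subsetneq\mathcal{N}$ and $C_\star$: $[\Lambda_\star([y_j][\lambda_i^\dagger],[y_i][\lambda_j^\dagger],[\gamma])]$;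 - if $\mathcal{L}_i,\mathcal{L}_j\subsetneq\mathcal{N}$, $\mathcal{L}_\cup=\mathcal{N}$: $[\lambda_t]+[\Lambda_r([\Lambda_r([y_j][\lambda_i^\dagger],[y_i][\lambda_j^\dagger])],[0,0])]$ if $\mathcal{L}_k\subsetneq\mathcal{L}_\cap$; $[\lambda_t]+[\Lambda_r([y_j][\lambda_i^\dagger],[y_i][\lambda_j^\dagger])]$ if $\mathcal{L}_k=\mathcal{L}_\cap$ and not $C_\star$; - if $\mathcal{L}_\cup\subsetneq\mathcal{N}$: $[\lambda_t]+[y_j][\lambda_i^\dagger]+[y_i][\lambda_j^\dagger]$ if $\mathcal{L}_k=\mathcal{L}_i=\mathcal{L}_j$; $[\lambda_t]+[y_j][\lambda_i^\dagger]+[y_i][\lambda_{j,0}]$ if $\mathcal{L}_k=\mathcal{L}_i\subsetneq\mathcal{L}_j$; $[\lambda_t]+[y_j][\lambda_{i,0}]+[y_i][\lambda_j^\dagger]$ if $\mathcal{L}_k=\mathcal{L}_j\subsetneq\mathcal{L}_i$; $[\lambda_t]+[\Lambda_r([y_j][\lambda_i^\dagger]+[y_i][\lambda_j^\dagger],[0,0])]$ if $\mathcal{L}_k\subsetneq\mathcal{L}_i=\mathcal{L}_j$; $[\lambda_t]+[\Lambda_r([y_j][\lambda_i^\dagger]+[y_i][\lambda_{j,0}],[0,0])]$ if $\mathcal{L}_k\subsetneq\mathcal{L}_i\subsetneq\mathcal{L}_j$; $[\lambda_t]+[\Lambda_r([y_j][\lambda_{i,0}]+[y_i][\lambda_j^\dagger],[0,0])]$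 if $\mathcal{L}_k\subsetneq\mathcal{L}_j\subsetneq\mathcal{L}_i$; $[\lambda_t]+[y_j][\lambda_{i,0}]+[y_i][\lambda_{j,0}]$ if $\mathcal{L}_i\nsubseteq\mathcal{L}_j$ and $\mathcal{L}_j\nsubseteq\mathcal{L}_i$. Unary nonlinear operations: if $\mathcal{L}_i=\mathcal{N}$: powNat $m(m-1)[y_i]^{m-2}[\Lambda_s^k]$; oneOver $2[y_k]^3[\Lambda_s^k]$; sqrt $(1/(-4[y_k]^3))[\Lambda_s^k]$; exp $[y_k][\Lambda_s^k]$; ln $(-1/[y_i]^2)[\Lambda_s^k]$. If $\mathcal{L}_i\subsetneq\mathcal{N}$, put $[\mu]=[\lambda_i^\dagger]$ when $\mathcal{L}_k=\mathcal{L}_i$ and $[\mu]=[\lambda_{i,0}]$ when $\mathcal{L}_k\subsetneq\mathcal{L}_i$: powNat $m[y_i]^{m-2}((m-1)[\Lambda_s^k]+[y_i][\mu])$; oneOver $[y_k]^2(2[y_k][\Lambda_s^k]-[\mu])$; sqrt $(1/(2[y_k]))\big((1/(-2[y_i]))[\Lambda_s^k]+[\mu]\big)$; exp $[y_k]([\Lambda_s^k]+[\mu])$; ln $(1/[y_i])\big([\mu]-(1/[y_i])[\Lambda_s^k]\big)$. addC, mulByC: $[0,0]$ if $\mathcal{L}_i=\mathcal{N}$; otherwise $[\lambda_i^\dagger]$ (addC), $c[\lambda_i^\dagger]$ (mulByC). *Step 3.* Output $[\lambda_\varphi^S]=[\lambda_{n+t}^\dagger]$ if $\mathcal{L}_{n+t}=\emptyset$;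 $[0,0]$ if $\mathcal{L}_{n+t}=\mathcal{N}$; $[\min\{\underline\lambda_{n+t}^\dagger,0\},\max\{\overline\lambda_{n+t}^\dagger,0\}]$ otherwise. *)

theory Defs
  imports "HOL-Analysis.Analysis" "HOL-Library.Interval"
begin

section \<open>Interval arithmetic\<close>

text \<open>
  Sums, products, negation, differences and the constants \<open>0 = [0,0]\<close>, \<open>1 = [1,1]\<close> are those of
  the type \<^typ>\<open>real interval\<close> of nonempty closed intervals; \<^const>\<open>sup\<close> is the interval hull
  \<open>[min, max]\<close> of two intervals, and \<open>A + interval_of c\<close> is the shift \<open>[a] + c\<close>.
  \<open>Interval (l, u)\<close> denotes \<open>[l,u]\<close> and is unspecified unless \<open>l \<le> u\<close>; below this matters only for
  \<open>irecip\<close> and \<open>iln\<close>, whose arguments must satisfy \<open>0 \<notin> [a]\<close> and \<open>lower a > 0\<close>.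
  The power \<open>ipow\<close> is not the iterated product given by the library's \<open>^\<close> on intervals:
  it yields \<open>[-1,1]\<^sup>2 = [0,1]\<close>, not \<open>[-1,1]\<close>.
\<close>

definition iscale :: "real \<Rightarrow> real interval \<Rightarrow> real interval"  (infixr \<open>\<odot>\<close> 75)
  where "c \<odot> a = (if c \<ge> 0 then Interval (c * lower a, c * upper a)
                  else Interval (c * upper a, c * lower a))"

definition ipow :: "real interval \<Rightarrow> nat \<Rightarrow> real interval"
  where "ipow a m =
    (if m = 0 then 1
     else if lower a > 0 \<or> odd m then Interval (lower a ^ m, upper a ^ m)
     else if upper a < 0 \<and> even m then Interval (upper a ^ m, lower a ^ m)
     else Interval (0, max (lower a ^ m) (upper a ^ m)))"

definition irecip :: "real interval \<Rightarrow> real interval"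
  where "irecip a = Interval (1 / upper a, 1 / lower a)"

definition isqrt :: "real interval \<Rightarrow> real interval"
  where "isqrt a = Interval (sqrt (lower a), sqrt (upper a))"

definition iexp :: "real interval \<Rightarrow> real interval"
  where "iexp a = Interval (exp (lower a), exp (upper a))"

definition iln :: "real interval \<Rightarrow> real interval"
  where "iln a = Interval (ln (lower a), ln (upper a))"

lemma lower_upper_Interval [simp]:
  assumes "l \<le> (u::real)"
  shows "lower (Interval (l, u)) = l" "upper (Interval (l, u)) = u"
  using assms by (simp_all add: lower.rep_eq upper.rep_eq Interval_inverse)


section \<open>Interval operators\<close>

text \<open>
  A hyperrectangle is a function from coordinate numbers to intervals. The operators take the set
  \<open>J\<close> of coordinates to which their arguments are restricted, so \<open>Lam_s J a\<close> is
  \<open>\<Lambda>\<^sub>s\<close> of the \<open>card J\<close>-dimensional hyperrectangle of the components of \<open>a\<close> in \<open>J\<close>.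
\<close>

definition sqmax :: "real interval \<Rightarrow> real"
  where "sqmax a = max ((lower a)\<^sup>2) ((upper a)\<^sup>2)"

definition Lam_s :: "nat set \<Rightarrow> (nat \<Rightarrow> real interval) \<Rightarrow> real interval"
  where "Lam_s J a =
    (if card J = 1 then ipow (a (the_elem J)) 2 else Interval (0, \<Sum>l\<in>J. sqmax (a l)))"

definition Lam_t :: "nat set \<Rightarrow> (nat \<Rightarrow> real interval) \<Rightarrow> (nat \<Rightarrow> real interval) \<Rightarrow> real interval"
  where "Lam_t J a b =
    (if card J = 1 then 2 \<odot> (a (the_elem J) * b (the_elem J))
     else (let \<beta> = sqrt ((\<Sum>l\<in>J. sqmax (a l)) * (\<Sum>l\<in>J. sqmax (b l)))
           in Interval (- \<beta>, \<beta>) + (\<Sum>l\<in>J. a l * b l)))"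

definition Lam_r :: "real interval \<Rightarrow> real interval \<Rightarrow> real interval"
  where "Lam_r a b = sup a b"

definition Lam_star :: "real interval \<Rightarrow> real interval \<Rightarrow> real interval \<Rightarrow> real interval"
  where "Lam_star a b c =
    (let d = 4 * max ((lower c)\<^sup>2) ((upper c)\<^sup>2)
     in (1/2) \<odot> Interval (lower a + lower b - sqrt ((lower a - lower b)\<^sup>2 + d),
                           upper a + upper b + sqrt ((upper a - upper b)\<^sup>2 + d)))"

text \<open>\<open>hull0 [\<lambda>] = [min {lower \<lambda>, 0}, max {upper \<lambda>, 0}]\<close>\<close>

definition hull0 :: "real interval \<Rightarrow> real interval"
  where "hull0 a = sup a 0"


section \<open>Codelists\<close>

datatype codeop =
    OpAdd nat nat
  | OpMul nat nat
  | OpPowNat nat nat  \<comment> \<open>\<open>OpPowNat i m\<close> stands for \<open>y\<^sub>i\<^sup>m\<close>\<close>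
  | OpOneOver nat
  | OpSqrt nat
  | OpExp nat
  | OpLn nat
  | OpAddC nat real
  | OpMulByC real nat

text \<open>
  \<open>run step k ps f\<close> extends the table \<open>f\<close>, whose entries \<open>1, \<dots>, k\<close> are already computed, by the
  entries \<open>k + 1, k + 2, \<dots>\<close>, one for each operation in \<open>ps\<close>; entry \<open>k'\<close> for the operation \<open>p\<close>
  is \<open>step k' p g\<close>, where \<open>g\<close> is the table computed so far. All data attached to a codelist are
  obtained from it, with \<open>k = n\<close> and the inputs as initial entries \<open>1, \<dots>, n\<close>.
\<close>

primrec run :: "(nat \<Rightarrow> codeop \<Rightarrow> (nat \<Rightarrow> 'a) \<Rightarrow> 'a) \<Rightarrow> nat \<Rightarrow> codeop list \<Rightarrow> (nat \<Rightarrow> 'a) \<Rightarrow> nat \<Rightarrow> 'a"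
  where
    "run step k [] f = f"
  | "run step k (p # ps) f = run step (Suc k) ps (f(Suc k := step (Suc k) p f))"

text \<open>The operation producing \<open>y\<^sub>k\<close>, for \<open>k = n + 1, \<dots>, n + length ops\<close>.\<close>

definition op_at :: "nat \<Rightarrow> codeop list \<Rightarrow> nat \<Rightarrow> codeop"
  where "op_at n ops k = ops ! (k - n - 1)"

fun args_ok :: "nat \<Rightarrow> codeop \<Rightarrow> bool"
  where
    "args_ok k (OpAdd i j) \<longleftrightarrow> i \<in> {1..<k} \<and> j \<in> {1..<k}"
  | "args_ok k (OpMul i j) \<longleftrightarrow> i \<in> {1..<k} \<and> j \<in> {1..<k}"
  | "args_ok k (OpPowNat i m) \<longleftrightarrow> i \<in> {1..<k} \<and> m \<ge> 2"
  | "args_ok k (OpOneOver i) \<longleftrightarrow> i \<in> {1..<k}"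
  | "args_ok k (OpSqrt i) \<longleftrightarrow> i \<in> {1..<k}"
  | "args_ok k (OpExp i) \<longleftrightarrow> i \<in> {1..<k}"
  | "args_ok k (OpLn i) \<longleftrightarrow> i \<in> {1..<k}"
  | "args_ok k (OpAddC i c) \<longleftrightarrow> i \<in> {1..<k}"
  | "args_ok k (OpMulByC c i) \<longleftrightarrow> i \<in> {1..<k}"

fun real_step :: "nat \<Rightarrow> codeop \<Rightarrow> (nat \<Rightarrow> real) \<Rightarrow> real"
  where
    "real_step k (OpAdd i j) y = y i + y j"
  | "real_step k (OpMul i j) y = y i * y j"
  | "real_step k (OpPowNat i m) y = y i ^ m"
  | "real_step k (OpOneOver i) y = 1 / y i"
  | "real_step k (OpSqrt i) y = sqrt (y i)"
  | "real_step k (OpExp i) y = exp (y i)"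
  | "real_step k (OpLn i) y = ln (y i)"
  | "real_step k (OpAddC i c) y = y i + c"
  | "real_step k (OpMulByC c i) y = c * y i"

fun real_op_defined :: "codeop \<Rightarrow> (nat \<Rightarrow> real) \<Rightarrow> bool"
  where
    "real_op_defined (OpOneOver i) y \<longleftrightarrow> y i \<noteq> 0"
  | "real_op_defined (OpSqrt i) y \<longleftrightarrow> y i \<ge> 0"
  | "real_op_defined (OpLn i) y \<longleftrightarrow> y i > 0"
  | "real_op_defined _ y \<longleftrightarrow> True"

text \<open>
  The coordinates of \<^typ>\<open>real^'n\<close> are numbered \<open>1, \<dots>, n\<close> by a bijection \<open>e\<close>, so that
  \<open>x\<^sub>k = x $ e k\<close>.
\<close>

definition codelist_values :: "(nat \<Rightarrow> 'n) \<Rightarrow> codeop list \<Rightarrow> real^'n \<Rightarrow> nat \<Rightarrow> real"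
  where "codelist_values e ops x = run real_step CARD('n) ops (\<lambda>k. x $ e k)"

text \<open>\<open>\<phi>\<close> is written on \<open>U\<close> as the codelist \<open>ops\<close> with \<open>t = length ops\<close> operations.\<close>

definition is_codelist ::
    "(nat \<Rightarrow> 'n::finite) \<Rightarrow> codeop list \<Rightarrow> (real^'n) set \<Rightarrow> (real^'n \<Rightarrow> real) \<Rightarrow> bool"
  where "is_codelist e ops U \<phi> \<longleftrightarrow>
    (\<forall>k \<in> {CARD('n)<..CARD('n) + length ops}. args_ok k (op_at CARD('n) ops k)) \<and>
    (\<forall>x\<in>U. (\<forall>k \<in> {CARD('n)<..CARD('n) + length ops}.
                real_op_defined (op_at CARD('n) ops k) (codelist_values e ops x)) \<and>
            \<phi> x = codelist_values e ops x (CARD('n) + length ops))"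


section \<open>Interval values and gradients\<close>

fun ival_step :: "nat \<Rightarrow> codeop \<Rightarrow> (nat \<Rightarrow> real interval) \<Rightarrow> real interval"
  where
    "ival_step k (OpAdd i j) Y = Y i + Y j"
  | "ival_step k (OpMul i j) Y = Y i * Y j"
  | "ival_step k (OpPowNat i m) Y = ipow (Y i) m"
  | "ival_step k (OpOneOver i) Y = irecip (Y i)"
  | "ival_step k (OpSqrt i) Y = isqrt (Y i)"
  | "ival_step k (OpExp i) Y = iexp (Y i)"
  | "ival_step k (OpLn i) Y = iln (Y i)"
  | "ival_step k (OpAddC i c) Y = Y i + interval_of c"
  | "ival_step k (OpMulByC c i) Y = c \<odot> Y i"

definition ivals :: "nat \<Rightarrow> (nat \<Rightarrow> real interval) \<Rightarrow> codeop list \<Rightarrow> nat \<Rightarrow> real interval"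
  where "ivals n X ops = run ival_step n ops X"

fun grad_step :: "(nat \<Rightarrow> real interval) \<Rightarrow>
    nat \<Rightarrow> codeop \<Rightarrow> (nat \<Rightarrow> nat \<Rightarrow> real interval) \<Rightarrow> nat \<Rightarrow> real interval"
  where
    "grad_step Y k (OpAdd i j) G = (\<lambda>l. G i l + G j l)"
  | "grad_step Y k (OpMul i j) G = (\<lambda>l. Y j * G i l + Y i * G j l)"
  | "grad_step Y k (OpPowNat i m) G = (\<lambda>l. (real m \<odot> ipow (Y i) (m - 1)) * G i l)"
  | "grad_step Y k (OpOneOver i) G = (\<lambda>l. (- ipow (Y k) 2) * G i l)"
  | "grad_step Y k (OpSqrt i) G = (\<lambda>l. irecip (2 \<odot> Y k) * G i l)"
  | "grad_step Y k (OpExp i) G = (\<lambda>l. Y k * G i l)"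
  | "grad_step Y k (OpLn i) G = (\<lambda>l. irecip (Y i) * G i l)"
  | "grad_step Y k (OpAddC i c) G = G i"
  | "grad_step Y k (OpMulByC c i) G = (\<lambda>l. c \<odot> G i l)"

text \<open>\<open>igrads n X ops k l\<close> is the \<open>l\<close>-th component of \<open>[\<nabla>y\<^sub>k]\<close>.\<close>

definition igrads :: "nat \<Rightarrow> (nat \<Rightarrow> real interval) \<Rightarrow> codeop list \<Rightarrow> nat \<Rightarrow> nat \<Rightarrow> real interval"
  where "igrads n X ops =
    run (grad_step (ivals n X ops)) n ops (\<lambda>k l. interval_of (if l = k then 1 else 0))"

text \<open>
  Well-definedness of all interval operations used by the two algorithms. For the square root, besides
  \<open>isqrt [y\<^sub>i]\<close> also \<open>1/(2[y\<^sub>k])\<close>, \<open>1/(-2[y\<^sub>i])\<close> and \<open>1/(-4[y\<^sub>k]\<^sup>3)\<close> occur; as \<open>[y\<^sub>k] = isqrt [y\<^sub>i]\<close>,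
  these are defined iff \<open>0 \<notin> [y\<^sub>k]\<close>.
\<close>

fun ival_op_defined :: "nat \<Rightarrow> codeop \<Rightarrow> (nat \<Rightarrow> real interval) \<Rightarrow> bool"
  where
    "ival_op_defined k (OpOneOver i) Y \<longleftrightarrow> 0 \<notin> set_of (Y i)"
  | "ival_op_defined k (OpSqrt i) Y \<longleftrightarrow> lower (Y i) \<ge> 0 \<and> 0 \<notin> set_of (Y k)"
  | "ival_op_defined k (OpLn i) Y \<longleftrightarrow> lower (Y i) > 0"
  | "ival_op_defined k _ Y \<longleftrightarrow> True"

definition ivals_well_defined :: "nat \<Rightarrow> (nat \<Rightarrow> real interval) \<Rightarrow> codeop list \<Rightarrow> bool"
  where "ivals_well_defined n X ops \<longleftrightarrow>
    (\<forall>k \<in> {n<..n + length ops}. ival_op_defined k (op_at n ops k) (ivals n X ops))"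


section \<open>Algorithm D\<close>

fun lamD_step :: "nat \<Rightarrow> (nat \<Rightarrow> real interval) \<Rightarrow> (nat \<Rightarrow> nat \<Rightarrow> real interval) \<Rightarrow>
    nat \<Rightarrow> codeop \<Rightarrow> (nat \<Rightarrow> real interval) \<Rightarrow> real interval"
  where
    "lamD_step n Y G k (OpAdd i j) lam = lam i + lam j"
  | "lamD_step n Y G k (OpMul i j) lam = Y j * lam i + Y i * lam j + Lam_t {1..n} (G i) (G j)"
  | "lamD_step n Y G k (OpPowNat i m) lam =
      (real m \<odot> ipow (Y i) (m - 2)) * ((real m - 1) \<odot> Lam_s {1..n} (G i) + Y i * lam i)"
  | "lamD_step n Y G k (OpOneOver i) lam =
      ipow (Y k) 2 * ((2 \<odot> Y k) * Lam_s {1..n} (G i) - lam i)"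
  | "lamD_step n Y G k (OpSqrt i) lam =
      irecip (2 \<odot> Y k) * (lam i + irecip ((-2) \<odot> Y i) * Lam_s {1..n} (G i))"
  | "lamD_step n Y G k (OpExp i) lam = Y k * (Lam_s {1..n} (G i) + lam i)"
  | "lamD_step n Y G k (OpLn i) lam =
      irecip (Y i) * (lam i - irecip (Y i) * Lam_s {1..n} (G i))"
  | "lamD_step n Y G k (OpAddC i c) lam = lam i"
  | "lamD_step n Y G k (OpMulByC c i) lam = c \<odot> lam i"

definition lamD :: "nat \<Rightarrow> (nat \<Rightarrow> real interval) \<Rightarrow> codeop list \<Rightarrow> nat \<Rightarrow> real interval"
  where "lamD n X ops = run (lamD_step n (ivals n X ops) (igrads n X ops)) n ops (\<lambda>k. 0)"

definition algorithm_D :: "nat \<Rightarrow> (nat \<Rightarrow> real interval) \<Rightarrow> codeop list \<Rightarrow> real interval"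
  where "algorithm_D n X ops = lamD n X ops (n + length ops)"


section \<open>Algorithm S\<close>

text \<open>Entry \<open>k\<close> of the table is the pair \<open>(\<I>\<^sub>k, \<L>\<^sub>k)\<close>.\<close>

fun index_step :: "nat \<Rightarrow> codeop \<Rightarrow> (nat \<Rightarrow> nat set \<times> nat set) \<Rightarrow> nat set \<times> nat set"
  where
    "index_step k (OpAdd i j) S = (fst (S i) \<inter> fst (S j), snd (S i) \<inter> snd (S j))"
  | "index_step k (OpMul i j) S = (fst (S i) \<inter> fst (S j), fst (S i) \<inter> fst (S j))"
  | "index_step k (OpPowNat i m) S = (fst (S i), fst (S i))"
  | "index_step k (OpOneOver i) S = (fst (S i), fst (S i))"
  | "index_step k (OpSqrt i) S = (fst (S i), fst (S i))"
  | "index_step k (OpExp i) S = (fst (S i), fst (S i))"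
  | "index_step k (OpLn i) S = (fst (S i), fst (S i))"
  | "index_step k (OpAddC i c) S = (fst (S i), snd (S i))"
  | "index_step k (OpMulByC c i) S = (fst (S i), snd (S i))"

definition index_sets :: "nat \<Rightarrow> codeop list \<Rightarrow> nat \<Rightarrow> nat set \<times> nat set"
  where "index_sets n ops = run index_step n ops (\<lambda>k. ({1..n} - {k}, {1..n}))"

definition I_set :: "nat \<Rightarrow> codeop list \<Rightarrow> nat \<Rightarrow> nat set"
  where "I_set n ops k = fst (index_sets n ops k)"

definition L_set :: "nat \<Rightarrow> codeop list \<Rightarrow> nat \<Rightarrow> nat set"
  where "L_set n ops k = snd (index_sets n ops k)"

definition C_star :: "nat \<Rightarrow> nat set \<Rightarrow> nat set \<Rightarrow> bool"
  where "C_star n Ii Ij \<longleftrightarrow> Ii \<union> Ij = {1..n} \<and> card Ii = n - 1 \<and> card Ij = n - 1"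

definition lamS_add ::
    "nat \<Rightarrow> nat set \<Rightarrow> nat set \<Rightarrow> real interval \<Rightarrow> real interval \<Rightarrow> real interval"
  where "lamS_add n Li Lj li lj =
    (let N = {1..n} in
     if Li = N \<and> Lj = N then 0
     else if Li \<subset> N \<and> Lj = N then li
     else if Lj \<subset> N \<and> Li = N then lj
     else if Li \<union> Lj = N then Lam_r li lj
     else if Li = Lj then li + lj
     else if Li \<subset> Lj then li + hull0 lj
     else if Lj \<subset> Li then hull0 li + lj
     else hull0 li + hull0 lj)"

text \<open>
  Here \<open>lt\<close> and \<open>gam\<close> are \<open>[\<lambda>\<^sub>t]\<close> and \<open>[\<gamma>]\<close>; \<open>gam\<close> is used only under \<open>C_star\<close>. In each group the
  last alternative is the only one left, since \<open>\<L>\<^sub>k = \<I>\<^sub>i \<inter> \<I>\<^sub>j\<close> with \<open>\<I>\<^sub>i \<subseteq> \<L>\<^sub>i\<close> and \<open>\<I>\<^sub>j \<subseteq> \<L>\<^sub>j\<close>.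
\<close>

definition lamS_mul ::
    "nat \<Rightarrow> nat set \<Rightarrow> nat set \<Rightarrow> nat set \<Rightarrow> nat set \<Rightarrow> real interval \<Rightarrow> real interval \<Rightarrow>
     real interval \<Rightarrow> real interval \<Rightarrow> real interval \<Rightarrow> real interval \<Rightarrow> real interval"
  where "lamS_mul n Ii Ij Li Lj yi yj li lj lt gam =
    (let N = {1..n}; Lk = Ii \<inter> Ij in
     if Li = N \<and> Lj = N then lt
     else if Li \<subset> N \<and> Lj = N then
       (if C_star n Ii Ij then Lam_star (yj * li) 0 gam
        else if Lk = Li then lt + yj * li
        else lt + yj * hull0 li)
     else if Lj \<subset> N \<and> Li = N then
       (if C_star n Ii Ij then Lam_star 0 (yi * lj) gam
        else if Lk = Lj then lt + yi * lj
        else lt + yi * hull0 lj)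
     else if C_star n Ii Ij then Lam_star (yj * li) (yi * lj) gam
     else if Li \<union> Lj = N then
       (if Lk \<subset> Li \<inter> Lj then lt + Lam_r (Lam_r (yj * li) (yi * lj)) 0
        else lt + Lam_r (yj * li) (yi * lj))
     else if Lk = Li \<and> Li = Lj then lt + yj * li + yi * lj
     else if Lk = Li \<and> Li \<subset> Lj then lt + yj * li + yi * hull0 lj
     else if Lk = Lj \<and> Lj \<subset> Li then lt + yj * hull0 li + yi * lj
     else if Lk \<subset> Li \<and> Li = Lj then lt + Lam_r (yj * li + yi * lj) 0
     else if Lk \<subset> Li \<and> Li \<subset> Lj then lt + Lam_r (yj * li + yi * hull0 lj) 0
     else if Lk \<subset> Lj \<and> Lj \<subset> Li then lt + Lam_r (yj * hull0 li + yi * lj) 0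
     else lt + yj * hull0 li + yi * hull0 lj)"

text \<open>\<open>[\<mu>]\<close> for a unary nonlinear operation with \<open>\<L>\<^sub>i\<close> a proper subset of \<open>\<N>\<close>.\<close>

definition mu :: "nat set \<Rightarrow> nat set \<Rightarrow> real interval \<Rightarrow> real interval"
  where "mu Lk Li li = (if Lk = Li then li else hull0 li)"

fun lamS_step :: "nat \<Rightarrow> (nat \<Rightarrow> real interval) \<Rightarrow> (nat \<Rightarrow> nat \<Rightarrow> real interval) \<Rightarrow>
    (nat \<Rightarrow> nat set) \<Rightarrow> (nat \<Rightarrow> nat set) \<Rightarrow>
    nat \<Rightarrow> codeop \<Rightarrow> (nat \<Rightarrow> real interval) \<Rightarrow> real interval"
  where
    "lamS_step n Y G I L k (OpAdd i j) lam = lamS_add n (L i) (L j) (lam i) (lam j)"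
  | "lamS_step n Y G I L k (OpMul i j) lam =
      lamS_mul n (I i) (I j) (L i) (L j) (Y i) (Y j) (lam i) (lam j)
        (Lam_t ({1..n} - L k) (G i) (G j))
        (G i (the_elem ({1..n} - I i)) * G j (the_elem ({1..n} - I j)))"
  | "lamS_step n Y G I L k (OpPowNat i m) lam =
      (let s = Lam_s ({1..n} - L k) (G i) in
       if L i = {1..n} then ((real m * (real m - 1)) \<odot> ipow (Y i) (m - 2)) * s
       else (real m \<odot> ipow (Y i) (m - 2)) * ((real m - 1) \<odot> s + Y i * mu (L k) (L i) (lam i)))"
  | "lamS_step n Y G I L k (OpOneOver i) lam =
      (let s = Lam_s ({1..n} - L k) (G i) in
       if L i = {1..n} then (2 \<odot> ipow (Y k) 3) * s
       else ipow (Y k) 2 * ((2 \<odot> Y k) * s - mu (L k) (L i) (lam i)))"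
  | "lamS_step n Y G I L k (OpSqrt i) lam =
      (let s = Lam_s ({1..n} - L k) (G i) in
       if L i = {1..n} then irecip ((-4) \<odot> ipow (Y k) 3) * s
       else irecip (2 \<odot> Y k) * (irecip ((-2) \<odot> Y i) * s + mu (L k) (L i) (lam i)))"
  | "lamS_step n Y G I L k (OpExp i) lam =
      (let s = Lam_s ({1..n} - L k) (G i) in
       if L i = {1..n} then Y k * s
       else Y k * (s + mu (L k) (L i) (lam i)))"
  | "lamS_step n Y G I L k (OpLn i) lam =
      (let s = Lam_s ({1..n} - L k) (G i) in
       if L i = {1..n} then (- irecip (ipow (Y i) 2)) * s
       else irecip (Y i) * (mu (L k) (L i) (lam i) - irecip (Y i) * s))"
  | "lamS_step n Y G I L k (OpAddC i c) lam = (if L i = {1..n} then 0 else lam i)"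
  | "lamS_step n Y G I L k (OpMulByC c i) lam = (if L i = {1..n} then 0 else c \<odot> lam i)"

definition lamS :: "nat \<Rightarrow> (nat \<Rightarrow> real interval) \<Rightarrow> codeop list \<Rightarrow> nat \<Rightarrow> real interval"
  where "lamS n X ops =
    run (lamS_step n (ivals n X ops) (igrads n X ops) (I_set n ops) (L_set n ops)) n ops (\<lambda>k. 0)"

definition algorithm_S :: "nat \<Rightarrow> (nat \<Rightarrow> real interval) \<Rightarrow> codeop list \<Rightarrow> real interval"
  where "algorithm_S n X ops =
    (let K = n + length ops in
     if L_set n ops K = {} then lamS n X ops K
     else if L_set n ops K = {1..n} then 0
     else hull0 (lamS n X ops K))"


section \<open>Twice continuous differentiability\<close>

text \<open>\<open>g\<close> is the gradient and \<open>H\<close> the Hessian of \<open>\<phi>\<close>; intended for open \<open>U\<close>.\<close>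

definition C2_on :: "(real^'n \<Rightarrow> real) \<Rightarrow> (real^'n::finite) set \<Rightarrow> bool"
  where "C2_on \<phi> U \<longleftrightarrow>
    (\<exists>(g :: real^'n \<Rightarrow> real^'n) (H :: real^'n \<Rightarrow> real^'n^'n).
       (\<forall>x\<in>U. (\<phi> has_derivative (\<lambda>h. g x \<bullet> h)) (at x) \<and>
               (g has_derivative (\<lambda>h. H x *v h)) (at x)) \<and>
       continuous_on U H)"

end

theory Submission
  imports Defs
begin

text \<open>
  Both algorithms compute the same values and gradients, so only the eigenvalue entries have to be
  compared. This is done by induction along the codelist, carrying for each entry \<open>k\<close>, besides
  \<open>[\<lambda>\<^sub>k\<^sup>S] \<subseteq> [\<lambda>\<^sub>k\<^sup>D]\<close>, a statement on where zero lies (\<open>dominates\<close>): if \<open>\<L>\<^sub>k = \<N>\<close>, the function is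
  affine and the direct algorithm returns exactly \<open>[0,0]\<close>; if \<open>\<L>\<^sub>k \<noteq> \<emptyset>\<close>, the direct interval contains
  \<open>0\<close>. The second part is what pays for everything the sparse algorithm adds to its intervals: it takes
  the hull with \<open>0\<close> only when it knows a zero row of some Hessian, that is, when the set in question is
  nonempty, and then \<open>0\<close> belongs to the direct interval as well.

  That \<open>0\<close> persists rests on two facts. Sums and products of intervals keep it. The operators
  \<open>\<Lambda>\<^sub>s\<close> and \<open>\<Lambda>\<^sub>t\<close> on all of \<open>\<N>\<close> contain it as soon as \<open>n \<noteq> 1\<close>, the latter by the Cauchy-Schwarz
  inequality (\<open>zero_le_Lam_t\<close>); and \<open>n \<noteq> 1\<close> holds whenever some index set is nonempty and proper.

  The sparse algorithm further replaces \<open>\<Lambda>\<^sub>s\<close> and \<open>\<Lambda>\<^sub>t\<close> over \<open>\<N>\<close> by the same operators over the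
  complement of \<open>\<L>\<^sub>k\<close>. This happens for nonlinear operations, where \<open>\<L>\<^sub>k\<close> consists of variables that occur
  in no argument, so that the gradients of the arguments vanish on \<open>\<L>\<^sub>k\<close> (\<open>grads_vanish\<close>), and the
  operators are monotone in the index set under this condition (\<open>Lam_s_mono\<close>, \<open>Lam_t_mono\<close>). Finally, \<open>\<Lambda>\<^sub>\<star>\<close> is
  dominated by the sum that the direct algorithm forms, since
  \<open>\<surd>((a - b)\<^sup>2 + 4 c\<^sup>2) \<le> \<bar>a - b\<bar> + 2 \<bar>c\<bar>\<close> (\<open>Lam_star_le\<close>).

  Throughout, inclusion is written as the order of the type of intervals. Thus \<open>A \<le> B\<close> means
  \<open>A \<subseteq> B\<close>, \<open>0 \<le> A\<close> means \<open>0 \<in> A\<close>, and \<open>sup\<close> is the hull.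
\<close>


section \<open>The inclusion order on intervals\<close>

lemma interval_le_iff_subset: "a \<le> b \<longleftrightarrow> set_of a \<subseteq> set_of b" for a b :: "real interval"
  by (auto simp: less_eq_interval_def set_of_eq)

lemma in_interval_iff: "x \<in> set_of A \<longleftrightarrow> lower A \<le> x \<and> x \<le> upper A" for A :: "real interval"
  by (auto simp: set_of_eq)

lemma interval_of_le_iff: "interval_of x \<le> A \<longleftrightarrow> x \<in> set_of A" for A :: "real interval"
  by (auto simp: less_eq_interval_def set_of_eq)

lemma lower_in_interval: "lower A \<in> set_of A" for A :: "real interval"
  by (simp add: in_interval_iff)

lemma upper_in_interval: "upper A \<in> set_of A" for A :: "real interval"
  by (simp add: in_interval_iff)

lemma interval_leI_endpoints:
  fixes A B :: "real interval"
  assumes "lower A \<in> set_of B" "upper A \<in> set_of B"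
  shows "A \<le> B"
  using assms by (auto simp: less_eq_interval_def set_of_eq)

lemma interval_times_mono:
  fixes A B :: "real interval"
  shows "A \<le> A' \<Longrightarrow> B \<le> B' \<Longrightarrow> A * B \<le> A' * B'"
  by (simp add: interval_le_iff_subset set_of_mul_inc)

lemma interval_uminus_mono: "A \<le> A' \<Longrightarrow> - A \<le> - A'" for A :: "real interval"
  by (simp add: less_eq_interval_def)

lemma interval_minus_mono:
  fixes A B :: "real interval"
  shows "A \<le> A' \<Longrightarrow> B \<le> B' \<Longrightarrow> A - B \<le> A' - B'"
  by (simp add: minus_interval_def interval_uminus_mono add_mono)

lemma zero_le_minus_interval: "0 \<le> A \<Longrightarrow> 0 \<le> B \<Longrightarrow> 0 \<le> A - B" for A :: "real interval"
  by (simp add: less_eq_interval_def)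

lemma zero_le_times_interval: "0 \<le> B \<Longrightarrow> 0 \<le> A * B" for A :: "real interval"
  using interval_times_mono[of A A 0 B] by simp

lemma interval_minus_zero: "A - 0 = A" for A :: "real interval"
  by (simp add: interval_eq_iff)

text \<open>
  This turns the associativity and monotonicity laws of interval products into laws for scaling, so
  that \<open>\<odot>\<close> needs no arithmetic of its own.
\<close>

lemma iscale_eq_times: "c \<odot> A = interval_of c * A"
proof -
  have "lower A \<le> upper A" by simp
  then show ?thesis
    by (auto simp: iscale_def interval_eq_iff lower_times upper_times mult_left_mono
        mult_left_mono_neg)
qed

lemma iscale_mono: "A \<le> B \<Longrightarrow> c \<odot> A \<le> c \<odot> B"
  by (simp add: iscale_eq_times interval_times_mono)

lemma iscale_zero: "c \<odot> 0 = 0"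
  by (simp add: iscale_eq_times)

lemma zero_le_iscale: "0 \<le> A \<Longrightarrow> 0 \<le> c \<odot> A"
  by (simp add: iscale_eq_times zero_le_times_interval)

lemma uminus_eq_times: "- A = interval_of (-1) * A" for A :: "real interval"
  by (simp add: interval_eq_iff lower_times upper_times)

lemma interval_of_mult: "interval_of x * interval_of y = interval_of (x * y)" for x y :: real
  by (simp add: interval_eq_iff lower_times upper_times)

lemma interval_mul_left_commute: "A * (B * C) = B * (A * C)" for A B C :: "real interval"
  by (metis interval_mul_commute mult.assoc)

lemmas interval_mult_ac = mult.assoc interval_mul_commute interval_mul_left_commute

lemma sqmax_nonneg: "0 \<le> sqmax A"
  by (simp add: sqmax_def le_max_iff_disj)

lemma power2_le_sqmax:
  assumes "x \<in> set_of A"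
  shows "x\<^sup>2 \<le> sqmax A"
proof -
  have x: "lower A \<le> x" "x \<le> upper A"
    using assms by (simp_all add: in_interval_iff)
  have "\<bar>x\<bar> \<le> \<bar>lower A\<bar> \<or> \<bar>x\<bar> \<le> \<bar>upper A\<bar>"
    using x by linarith
  then show ?thesis
    by (auto simp: sqmax_def le_max_iff_disj abs_le_square_iff)
qed

text \<open>
  The key estimate for \<open>\<beta>\<close>: both the one-dimensional \<open>\<Lambda>\<^sub>t\<close> and the \<open>[\<gamma>]\<close> of \<open>\<Lambda>\<^sub>\<star>\<close> are products of
  two gradient components, whose size it bounds by the factors under the root in \<open>\<beta>\<close>.
\<close>

lemma sqmax_times_le: "sqmax (A * B) \<le> sqmax A * sqmax B"
proof -
  have "z\<^sup>2 \<le> sqmax A * sqmax B" if "z \<in> set_of (A * B)" for z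
    using that
  proof (rule times_in_intervalE)
    fix x y assume "z = x * y" "x \<in> set_of A" "y \<in> set_of B"
    then show ?thesis
      by (auto simp: power_mult_distrib intro!: mult_mono power2_le_sqmax sqmax_nonneg)
  qed
  then show ?thesis
    by (simp add: sqmax_def[of "A * B"] in_interval_iff)
qed

lemma le_symmetric_interval:
  assumes "sqmax A \<le> b\<^sup>2" "0 \<le> b"
  shows "A \<le> Interval (- b, b)"
proof -
  have "(lower A)\<^sup>2 \<le> b\<^sup>2" "(upper A)\<^sup>2 \<le> b\<^sup>2"
    using assms(1) by (auto simp: sqmax_def)
  then have "\<bar>lower A\<bar> \<le> b" "\<bar>upper A\<bar> \<le> b"
    using assms(2) by (auto simp: abs_le_square_iff[symmetric])
  then show ?thesis
    using assms(2) by (auto simp: less_eq_interval_def)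
qed


section \<open>Monotonicity of the eigenvalue operators in the index set\<close>

lemma ipow_2_bounds: "0 \<le> lower (ipow A 2)" "upper (ipow A 2) \<le> sqmax A"
proof -
  have le: "lower A \<le> upper A" by simp
  have "lower A > 0 \<Longrightarrow> (lower A)\<^sup>2 \<le> (upper A)\<^sup>2" "upper A < 0 \<Longrightarrow> (upper A)\<^sup>2 \<le> (lower A)\<^sup>2"
    using le power_mono[of "lower A" "upper A" 2] power_mono[of "- upper A" "- lower A" 2]
    by simp_all
  then show "0 \<le> lower (ipow A 2)" "upper (ipow A 2) \<le> sqmax A"
    by (auto simp: ipow_def sqmax_def le_max_iff_disj)
qed

text \<open>
  Only the change of definition at cardinality \<open>1\<close> needs attention: a proper nonempty subset forces
  \<open>card K \<noteq> 1\<close>, and then \<open>[0, \<Sum>]\<close> also contains the sharper square of a single component. For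
  \<open>J = {}\<close> and \<open>card K = 1\<close> the inclusion can fail.
\<close>

lemma Lam_s_mono:
  assumes "finite K" "J \<subseteq> K" "J \<noteq> {}"
  shows "Lam_s J a \<le> Lam_s K a"
proof (cases "J = K")
  case False
  have fin: "finite J" using assms finite_subset by blast
  have "0 < card J" using fin assms(3) by (simp add: card_gt_0_iff)
  moreover have "card J < card K"
    using False assms by (meson psubsetI psubset_card_mono)
  ultimately have K: "card K \<noteq> 1" by linarith
  have sums: "(\<Sum>l\<in>J. sqmax (a l)) \<le> (\<Sum>l\<in>K. sqmax (a l))"
    using assms by (intro sum_mono2) (auto simp: sqmax_nonneg)
  have nonneg: "0 \<le> (\<Sum>l\<in>J. sqmax (a l))" "0 \<le> (\<Sum>l\<in>K. sqmax (a l))"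
    by (auto intro: sum_nonneg sqmax_nonneg)
  show ?thesis
  proof (cases "card J = 1")
    case True
    then obtain p where "J = {p}" by (rule card_1_singletonE)
    then show ?thesis
      using sums nonneg K ipow_2_bounds[of "a p"] by (auto simp: Lam_s_def less_eq_interval_def)
  next
    case False
    then show ?thesis
      using sums nonneg K by (auto simp: Lam_s_def less_eq_interval_def)
  qed
qed simp

lemma zero_le_Lam_s:
  assumes "card K \<noteq> 1"
  shows "0 \<le> Lam_s K a"
  using assms sum_nonneg[of K "\<lambda>l. sqmax (a l)"]
  by (simp add: Lam_s_def less_eq_interval_def sqmax_nonneg)

lemma symmetric_interval_mono:
  fixes x :: real
  assumes "0 \<le> x" "x \<le> y"
  shows "Interval (- x, x) \<le> Interval (- y, y)"
  using assms by (simp add: less_eq_interval_def)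

lemma sqmax_mult_le_sums:
  assumes "finite K" "p \<in> K" "q \<in> K"
  shows "sqmax (a p) * sqmax (b q) \<le> (\<Sum>l\<in>K. sqmax (a l)) * (\<Sum>l\<in>K. sqmax (b l))"
  using assms by (intro mult_mono member_le_sum) (auto simp: sqmax_nonneg intro: sum_nonneg)

text \<open>
  The coordinates dropped from the sum of products contribute nothing to it, while \<open>\<beta>\<close> can only
  grow. If \<open>J = {p}\<close>, one of the two copies of \<open>a\<^sub>p b\<^sub>p\<close> is the sum and the other one
  fits into \<open>[-\<beta>, \<beta>]\<close>.
\<close>

lemma Lam_t_mono:
  assumes "finite K" "J \<subseteq> K" "J \<noteq> {}" and vanish: "\<And>l. l \<in> K - J \<Longrightarrow> a l * b l = 0"
  shows "Lam_t J a b \<le> Lam_t K a b"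
proof (cases "J = K")
  case False
  have fin: "finite J" using assms finite_subset by blast
  have "0 < card J" using fin assms(3) by (simp add: card_gt_0_iff)
  moreover have "card J < card K"
    using False assms by (meson psubsetI psubset_card_mono)
  ultimately have K: "card K \<noteq> 1" by linarith
  have sum_eq: "(\<Sum>l\<in>J. a l * b l) = (\<Sum>l\<in>K. a l * b l)"
    using assms by (intro sum.mono_neutral_left) auto
  let ?\<beta> = "\<lambda>J. sqrt ((\<Sum>l\<in>J. sqmax (a l)) * (\<Sum>l\<in>J. sqmax (b l)))"
  have nonneg: "0 \<le> (\<Sum>l\<in>J. sqmax (f l))" for J and f :: "'a \<Rightarrow> real interval"
    by (auto intro: sum_nonneg sqmax_nonneg)
  show ?thesis
  proof (cases "card J = 1")
    case True
    then obtain p where p: "J = {p}" by (rule card_1_singletonE)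
    have "2 \<odot> (a p * b p) = a p * b p + a p * b p"
      by (simp add: iscale_def interval_eq_iff)
    also have "sqmax (a p * b p) \<le> (?\<beta> K)\<^sup>2"
      using sqmax_times_le[of "a p" "b p"] sqmax_mult_le_sums[of K p p a b] assms(1,2) p
      by (simp add: nonneg)
    then have "a p * b p + a p * b p \<le> Interval (- ?\<beta> K, ?\<beta> K) + a p * b p"
      by (intro add_right_mono le_symmetric_interval) (simp_all add: nonneg)
    finally show ?thesis
      using True K p sum_eq by (simp add: Lam_t_def Let_def)
  next
    case False
    have "?\<beta> J \<le> ?\<beta> K"
      using assms
      by (auto intro!: mult_mono sum_mono2 simp: sqmax_nonneg nonneg)
    then have "Interval (- ?\<beta> J, ?\<beta> J) \<le> Interval (- ?\<beta> K, ?\<beta> K)"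
      by (intro symmetric_interval_mono) (simp_all add: nonneg)
    then show ?thesis
      using False K sum_eq by (simp add: Lam_t_def Let_def add_right_mono)
  qed
qed simp

text \<open>
  Pick a point in each component, say the lower bounds. By the Cauchy-Schwarz inequality their inner
  product \<open>z\<close> satisfies \<open>\<bar>z\<bar> \<le> \<beta>\<close>, so \<open>-z \<in> [-\<beta>, \<beta>]\<close> cancels \<open>z\<close> in the sum of products.
\<close>

lemma zero_le_Lam_t:
  assumes "finite K" "card K \<noteq> 1"
  shows "0 \<le> Lam_t K a b"
proof -
  let ?\<beta> = "sqrt ((\<Sum>l\<in>K. sqmax (a l)) * (\<Sum>l\<in>K. sqmax (b l)))"
  define z where "z = (\<Sum>l\<in>K. lower (a l) * lower (b l))"
  have nonneg: "0 \<le> (\<Sum>l\<in>J. sqmax (f l))" for J and f :: "'a \<Rightarrow> real interval"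
    by (auto intro: sum_nonneg sqmax_nonneg)
  have "z\<^sup>2 \<le> (\<Sum>l\<in>K. (lower (a l))\<^sup>2) * (\<Sum>l\<in>K. (lower (b l))\<^sup>2)"
    unfolding z_def by (rule Cauchy_Schwarz_ineq_sum)
  also have "\<dots> \<le> (\<Sum>l\<in>K. sqmax (a l)) * (\<Sum>l\<in>K. sqmax (b l))"
    by (intro mult_mono sum_mono) (auto simp: nonneg power2_le_sqmax in_interval_iff intro: sum_nonneg)
  finally have "\<bar>z\<bar> \<le> ?\<beta>"
    by (simp add: real_le_rsqrt)
  then have "interval_of (- z) \<le> Interval (- ?\<beta>, ?\<beta>)"
    by (auto simp: less_eq_interval_def nonneg)
  moreover have "interval_of z \<le> (\<Sum>l\<in>K. a l * b l)"
  proof -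
    have "interval_of z = (\<Sum>l\<in>K. interval_of (lower (a l) * lower (b l)))"
      unfolding z_def using assms(1)
      by (induction K rule: finite_induct) (auto simp: interval_eq_iff)
    also have "\<dots> \<le> (\<Sum>l\<in>K. a l * b l)"
      by (intro sum_mono) (simp add: interval_of_le_iff times_in_intervalI lower_in_interval)
    finally show ?thesis .
  qed
  ultimately have "interval_of (- z) + interval_of z \<le> Lam_t K a b"
    using assms(2) by (simp add: Lam_t_def Let_def add_mono)
  moreover have "interval_of (- z) + interval_of z = 0"
    by (simp add: interval_eq_iff)
  ultimately show ?thesis by simp
qed

text \<open>
  Under the condition \<open>C\<^sub>\<star>\<close> each gradient has a single nonzero component, at \<open>p\<close> and
  at \<open>q \<noteq> p\<close>. The sum of products is then zero, and what remains of the direct \<open>\<Lambda>\<^sub>t\<close> has to absorb the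
  size of \<open>[\<gamma>] = a\<^sub>p b\<^sub>q\<close>.
\<close>

lemma symmetric_interval_le_Lam_t:
  assumes "finite K" "card K \<noteq> 1" "p \<in> K" "q \<in> K" and vanish: "\<And>l. l \<in> K \<Longrightarrow> a l * b l = 0"
  shows "Interval (- sqrt (sqmax (a p * b q)), sqrt (sqmax (a p * b q))) \<le> Lam_t K a b"
proof -
  have "sqmax (a p * b q) \<le> (\<Sum>l\<in>K. sqmax (a l)) * (\<Sum>l\<in>K. sqmax (b l))"
    using sqmax_times_le[of "a p" "b q"] sqmax_mult_le_sums[of K p q a b] assms by linarith
  then have "Interval (- sqrt (sqmax (a p * b q)), sqrt (sqmax (a p * b q))) \<le>
      Interval (- sqrt ((\<Sum>l\<in>K. sqmax (a l)) * (\<Sum>l\<in>K. sqmax (b l))),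
        sqrt ((\<Sum>l\<in>K. sqmax (a l)) * (\<Sum>l\<in>K. sqmax (b l))))"
    by (intro symmetric_interval_mono) (simp_all add: sqmax_nonneg)
  then show ?thesis
    using assms by (simp add: Lam_t_def Let_def)
qed

text \<open>
  With \<open>b\<close> the largest absolute value in \<open>c\<close>, the upper end of \<open>\<Lambda>\<^sub>\<star>\<close> is at most
  \<open>max (upper A) (upper B) + b\<close>, as \<open>\<surd>(x\<^sup>2 + 4 b\<^sup>2) \<le> \<bar>x\<bar> + 2 b\<close>. Because \<open>A'\<close> and \<open>B'\<close> contain \<open>0\<close>, this
  maximum is bounded by \<open>upper A' + upper B'\<close>. The lower end is symmetric.
\<close>

lemma Lam_star_le:
  assumes A: "A \<le> A'" "0 \<le> A'" and B: "B \<le> B'" "0 \<le> B'"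
    and T: "Interval (- sqrt (sqmax c), sqrt (sqmax c)) \<le> T"
  shows "Lam_star A B c \<le> A' + B' + T"
proof -
  define b where "b = sqrt (sqmax c)"
  have b0: "0 \<le> b" and d: "4 * max ((lower c)\<^sup>2) ((upper c)\<^sup>2) = (2 * b)\<^sup>2"
    by (auto simp: b_def sqmax_nonneg power_mult_distrib) (simp add: sqmax_def)
  have root: "sqrt (x\<^sup>2 + (2 * b)\<^sup>2) \<le> \<bar>x\<bar> + 2 * b" for x
    using sqrt_sum_squares_le_sum_abs[of x "2 * b"] b0 by simp
  define lo where "lo = lower A + lower B - sqrt ((lower A - lower B)\<^sup>2 + (2 * b)\<^sup>2)"
  define hi where "hi = upper A + upper B + sqrt ((upper A - upper B)\<^sup>2 + (2 * b)\<^sup>2)"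
  have "lower A \<le> upper A" "lower B \<le> upper B" by simp_all
  moreover have "0 \<le> sqrt ((lower A - lower B)\<^sup>2 + (2 * b)\<^sup>2)"
    "0 \<le> sqrt ((upper A - upper B)\<^sup>2 + (2 * b)\<^sup>2)" by simp_all
  ultimately have "lo \<le> hi" unfolding lo_def hi_def by linarith
  then have star: "lower (Lam_star A B c) = lo / 2" "upper (Lam_star A B c) = hi / 2"
    by (simp_all add: Lam_star_def Let_def d lo_def hi_def iscale_def)
  have T': "lower T \<le> - b" "b \<le> upper T"
    using T b0 by (simp_all add: less_eq_interval_def b_def[symmetric])
  have "min (lower A) (lower B) - b \<le> lo / 2"
    using root[of "lower A - lower B"] unfolding lo_def by (simp add: min_def) linarith
  moreover have "hi / 2 \<le> max (upper A) (upper B) + b"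
    using root[of "upper A - upper B"] unfolding hi_def by (simp add: max_def) linarith
  ultimately show ?thesis
    using A B T' by (auto simp: less_eq_interval_def star)
qed


section \<open>Dominance and its propagation through the operations\<close>

text \<open>
  The sparse entry is compared only for \<open>\<L> \<noteq> \<N>\<close>, since for \<open>\<L> = \<N>\<close> it influences neither later
  entries nor the output. The other two clauses record where zero lies in the direct entry.
\<close>

definition dominates :: "nat \<Rightarrow> nat set \<Rightarrow> real interval \<Rightarrow> real interval \<Rightarrow> bool"
  where "dominates n L s d \<longleftrightarrow>
    (L = {1..n} \<longrightarrow> d = 0) \<and> (L \<noteq> {1..n} \<longrightarrow> s \<le> d) \<and> (L \<noteq> {} \<longrightarrow> 0 \<le> d)"

text \<open>
  \<open>\<I> \<noteq> \<N>\<close> holds because an input depends on its own coordinate and index sets only shrink. It makes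
  the complement of \<open>\<I>\<close> nonempty, as the monotonicity of the operators requires.
\<close>

definition index_ok :: "nat \<Rightarrow> nat set \<Rightarrow> nat set \<Rightarrow> bool"
  where "index_ok n I L \<longleftrightarrow> I \<subseteq> L \<and> L \<subseteq> {1..n} \<and> I \<noteq> {1..n}"

lemma dominatesI_proper:
  assumes "L \<noteq> {1..n}" "s \<le> d" "L \<noteq> {} \<Longrightarrow> 0 \<le> d"
  shows "dominates n L s d"
  using assms by (auto simp: dominates_def)

lemma index_ok_same: "index_ok n I L \<Longrightarrow> index_ok n I I"
  by (auto simp: index_ok_def)

lemma index_ok_Int:
  "index_ok n I L \<Longrightarrow> index_ok n I' L' \<Longrightarrow> index_ok n (I \<inter> I') (L \<inter> L')"
  by (auto simp: index_ok_def)

lemma hull0_le: "a \<le> b \<Longrightarrow> 0 \<le> b \<Longrightarrow> hull0 a \<le> b"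
  by (simp add: hull0_def)

text \<open>
  If \<open>\<L>\<^sub>i \<union> \<L>\<^sub>j = \<N>\<close> with both sets proper, both are nonempty. So both direct intervals contain \<open>0\<close>,
  and their sum contains each of them, hence the hull of the sparse ones.
\<close>

lemma dominates_add:
  assumes "dominates n Li li di" "dominates n Lj lj dj" "Li \<subseteq> {1..n}" "Lj \<subseteq> {1..n}"
  shows "dominates n (Li \<inter> Lj) (lamS_add n Li Lj li lj) (di + dj)"
proof (cases "Li \<inter> Lj = {1..n}")
  case True
  then have "Li = {1..n}" "Lj = {1..n}" using assms(3,4) by auto
  then show ?thesis using assms by (auto simp: dominates_def)
next
  case False
  have zero: "Li \<noteq> {} \<Longrightarrow> 0 \<le> di" "Lj \<noteq> {} \<Longrightarrow> 0 \<le> dj"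
    and linear: "Li = {1..n} \<Longrightarrow> di = 0" "Lj = {1..n} \<Longrightarrow> dj = 0"
    and le: "Li \<noteq> {1..n} \<Longrightarrow> li \<le> di" "Lj \<noteq> {1..n} \<Longrightarrow> lj \<le> dj"
    using assms by (auto simp: dominates_def)
  have S: "lamS_add n Li Lj li lj \<le> di + dj"
  proof (cases "Li = {1..n} \<or> Lj = {1..n}")
    case True
    with False assms linear le show ?thesis
      by (auto simp: lamS_add_def Let_def)
  next
    case nonlinear: False
    show ?thesis
    proof (cases "Li \<union> Lj = {1..n}")
      case True
      with nonlinear have "Li \<noteq> {}" "Lj \<noteq> {}" by auto
      with nonlinear zero le have "sup li lj \<le> di + dj"
        by (auto intro: add_increasing add_increasing2)
      with nonlinear True show ?thesis
        by (simp add: lamS_add_def Lam_r_def)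
    next
      case False
      with nonlinear show ?thesis
        by (auto simp: lamS_add_def Let_def intro!: add_mono hull0_le le zero)
    qed
  qed
  show ?thesis
    using False S zero by (intro dominatesI_proper) (auto intro: add_nonneg_nonneg)
qed


text \<open>
  In every alternative in which \<open>[\<lambda>\<^sub>i]\<close> is enlarged by \<open>0\<close>, or the result is, the corresponding set is
  nonempty, so that the direct interval contains \<open>0\<close> too. Under \<open>C\<^sub>\<star>\<close> both \<open>\<I>\<^sub>i\<close> and \<open>\<I>\<^sub>j\<close> are
  nonempty, which is what \<open>Lam_star_le\<close> asks for.
\<close>

lemma dominates_mul:
  assumes "dominates n Li li di" "dominates n Lj lj dj" "index_ok n Ii Li" "index_ok n Ij Lj"
    and lt: "lt \<le> T" and T: "Ii \<inter> Ij \<noteq> {} \<Longrightarrow> 0 \<le> T"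
    and star: "C_star n Ii Ij \<Longrightarrow> Interval (- sqrt (sqmax gam), sqrt (sqmax gam)) \<le> T"
  shows "dominates n (Ii \<inter> Ij) (lamS_mul n Ii Ij Li Lj yi yj li lj lt gam)
    (yj * di + yi * dj + T)"
proof -
  have sub: "Ii \<subseteq> Li" "Ij \<subseteq> Lj" "Li \<subseteq> {1..n}" "Lj \<subseteq> {1..n}"
    and Lk: "Ii \<inter> Ij \<noteq> {1..n}" and ne: "Ii \<noteq> {1..n}" "Ij \<noteq> {1..n}"
    using assms(3,4) by (auto simp: index_ok_def)
  define A B where "A = yj * di" and "B = yi * dj"
  have linear: "Li = {1..n} \<Longrightarrow> A = 0" "Lj = {1..n} \<Longrightarrow> B = 0"
    and zero: "Li \<noteq> {} \<Longrightarrow> 0 \<le> A" "Lj \<noteq> {} \<Longrightarrow> 0 \<le> B"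
    and le: "Li \<noteq> {1..n} \<Longrightarrow> yj * li \<le> A" "Lj \<noteq> {1..n} \<Longrightarrow> yi * lj \<le> B"
    and hull: "Li \<noteq> {1..n} \<Longrightarrow> Li \<noteq> {} \<Longrightarrow> yj * hull0 li \<le> A"
      "Lj \<noteq> {1..n} \<Longrightarrow> Lj \<noteq> {} \<Longrightarrow> yi * hull0 lj \<le> B"
    using assms(1,2)
    by (auto simp: A_def B_def dominates_def hull0_le interval_times_mono zero_le_times_interval)
  let ?S = "lamS_mul n Ii Ij Li Lj yi yj li lj lt gam"
  have "?S \<le> T + (A + B)"
  proof (cases "C_star n Ii Ij")
    case True
    have ne0: "Ii \<noteq> {}" "Ij \<noteq> {}"
      using True sub ne by (auto simp: C_star_def)
    \<comment> \<open>One formula for the three alternatives with \<open>\<Lambda>\<^sub>\<star>\<close>: the factor of an affine argument is \<open>0\<close>.\<close>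
    define A' B' where "A' = (if Li = {1..n} then 0 else yj * li)"
      and "B' = (if Lj = {1..n} then 0 else yi * lj)"
    show ?thesis
    proof (cases "Li = {1..n} \<and> Lj = {1..n}")
      case True
      then show ?thesis using lt linear by (simp add: lamS_mul_def)
    next
      case False
      have "?S = Lam_star A' B' gam"
        using True False sub by (auto simp: lamS_mul_def Let_def A'_def B'_def)
      also have "\<dots> \<le> A + B + T"
        using ne0 sub star[OF True] zero linear le
        by (intro Lam_star_le) (auto simp: A'_def B'_def)
      finally show ?thesis by (simp add: add.commute)
    qed
  next
    case nostar: False
    consider "Li = {1..n}" "Lj = {1..n}" | "Li \<noteq> {1..n}" "Lj = {1..n}"
      | "Li = {1..n}" "Lj \<noteq> {1..n}" | "Li \<noteq> {1..n}" "Lj \<noteq> {1..n}" by blast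
    then show ?thesis
    proof cases
      case 1
      then show ?thesis using lt linear by (simp add: lamS_mul_def)
    next
      case 2
      then have "?S = lt + (if Ii \<inter> Ij = Li then yj * li else yj * hull0 li)"
        using nostar sub by (auto simp: lamS_mul_def Let_def)
      moreover have "Ii \<inter> Ij \<noteq> Li \<Longrightarrow> Li \<noteq> {}" using sub by auto
      ultimately show ?thesis using 2 lt le hull linear by (auto intro: add_mono)
    next
      case 3
      then have "?S = lt + (if Ii \<inter> Ij = Lj then yi * lj else yi * hull0 lj)"
        using nostar sub by (auto simp: lamS_mul_def Let_def)
      moreover have "Ii \<inter> Ij \<noteq> Lj \<Longrightarrow> Lj \<noteq> {}" using sub by auto
      ultimately show ?thesis using 3 lt le hull linear by (auto intro: add_mono)
    next
      case 4
      note leAB = le(1)[OF 4(1)] le(2)[OF 4(2)]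
      have Lk_sub: "Ii \<inter> Ij \<subseteq> Li" "Ii \<inter> Ij \<subseteq> Lj" using sub by auto
      show ?thesis
      proof (cases "Li \<union> Lj = {1..n}")
        case True
        with 4 have "Li \<noteq> {}" "Lj \<noteq> {}" by auto
        then have "0 \<le> A" "0 \<le> B" using zero by blast+
        then have "sup (yj * li) (yi * lj) \<le> A + B" "0 \<le> A + B"
          using leAB by (auto intro: add_increasing add_increasing2)
        then show ?thesis
          using 4 True nostar lt sub
          by (auto simp: lamS_mul_def Let_def Lam_r_def intro!: add_mono)
      next
        case False
        have hullA: "Li \<noteq> {} \<Longrightarrow> yj * hull0 li \<le> A" and hullB: "Lj \<noteq> {} \<Longrightarrow> yi * hull0 lj \<le> B"
          using hull 4 by auto
        have plain: "lt + a + b \<le> T + (A + B)" if "a \<le> A" "b \<le> B" for a b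
          using add_mono[OF lt add_mono[OF that]] by (simp add: add.assoc)
        have with_zero: "lt + Lam_r (a + b) 0 \<le> T + (A + B)"
          if "a \<le> A" "b \<le> B" "0 \<le> A" "0 \<le> B" for a b
          using that lt unfolding Lam_r_def
          by (intro add_mono sup_least add_nonneg_nonneg)
        note S = lamS_mul_def[of n Ii Ij Li Lj yi yj li lj lt gam, unfolded Let_def]
        consider (eq) "Ii \<inter> Ij = Li" "Li = Lj"
          | (eq_i) "Ii \<inter> Ij = Li" "Li \<subset> Lj"
          | (eq_j) "Ii \<inter> Ij = Lj" "Lj \<subset> Li"
          | (lt_eq) "Ii \<inter> Ij \<subset> Li" "Li = Lj"
          | (lt_i) "Ii \<inter> Ij \<subset> Li" "Li \<subset> Lj"
          | (lt_j) "Ii \<inter> Ij \<subset> Lj" "Lj \<subset> Li"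
          | (incomp) "\<not> Li \<subseteq> Lj" "\<not> Lj \<subseteq> Li"
          using Lk_sub by blast
        then show ?thesis
        proof cases
          case eq
          then have "?S = lt + yj * li + yi * lj"
            unfolding S using False 4 nostar by simp
          then show ?thesis using leAB by (simp add: plain)
        next
          case eq_i
          then have "Ii \<inter> Ij \<noteq> Lj" "Li \<noteq> Lj" "Lj \<noteq> {}" by auto
          then have "?S = lt + yj * li + yi * hull0 lj"
            unfolding S using eq_i False 4 nostar by simp
          then show ?thesis using leAB hullB[OF \<open>Lj \<noteq> {}\<close>] by (simp add: plain)
        next
          case eq_j
          then have "Ii \<inter> Ij \<noteq> Li" "Li \<noteq> Lj" "Li \<noteq> {}" by auto
          then have "?S = lt + yj * hull0 li + yi * lj"
            unfolding S using eq_j False 4 nostar by simp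
          then show ?thesis using leAB hullA[OF \<open>Li \<noteq> {}\<close>] by (simp add: plain)
        next
          case lt_eq
          then have "Ii \<inter> Ij \<noteq> Lj" "Li \<noteq> {}" "Lj \<noteq> {}" by auto
          then have "?S = lt + Lam_r (yj * li + yi * lj) 0"
            unfolding S using lt_eq False 4 nostar by simp
          then show ?thesis
            using leAB zero(1)[OF \<open>Li \<noteq> {}\<close>] zero(2)[OF \<open>Lj \<noteq> {}\<close>] by (simp add: with_zero)
        next
          case lt_i
          then have "Ii \<inter> Ij \<noteq> Li" "Ii \<inter> Ij \<noteq> Lj" "Li \<noteq> Lj" "Li \<noteq> {}" "Lj \<noteq> {}" by auto
          then have "?S = lt + Lam_r (yj * li + yi * hull0 lj) 0"
            unfolding S using lt_i False 4 nostar by simp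
          then show ?thesis
            using leAB hullB[OF \<open>Lj \<noteq> {}\<close>] zero(1)[OF \<open>Li \<noteq> {}\<close>] zero(2)[OF \<open>Lj \<noteq> {}\<close>]
            by (simp add: with_zero)
        next
          case lt_j
          then have "Ii \<inter> Ij \<noteq> Li" "Ii \<inter> Ij \<noteq> Lj" "Li \<noteq> Lj" "\<not> Li \<subset> Lj" "Li \<noteq> {}" "Lj \<noteq> {}"
            by auto
          then have "?S = lt + Lam_r (yj * hull0 li + yi * lj) 0"
            unfolding S using lt_j False 4 nostar by simp
          then show ?thesis
            using leAB hullA[OF \<open>Li \<noteq> {}\<close>] zero(1)[OF \<open>Li \<noteq> {}\<close>] zero(2)[OF \<open>Lj \<noteq> {}\<close>]
            by (simp add: with_zero)
        next
          case incomp
          then have "\<not> Li \<subset> Lj" "\<not> Lj \<subset> Li" "Li \<noteq> Lj" "Li \<noteq> {}" "Lj \<noteq> {}" by auto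
          then have "?S = lt + yj * hull0 li + yi * hull0 lj"
            unfolding S using False 4 nostar by simp
          then show ?thesis
            using hullA[OF \<open>Li \<noteq> {}\<close>] hullB[OF \<open>Lj \<noteq> {}\<close>] by (simp add: plain)
        qed
      qed
    qed
  qed
  then have "?S \<le> yj * di + yi * dj + T"
    by (simp add: A_def B_def ac_simps)
  then show ?thesis
    using Lk sub zero T unfolding A_def B_def
    by (intro dominatesI_proper add_nonneg_nonneg) auto
qed

lemma dominates_scale:
  assumes "dominates n L s d"
  shows "dominates n L (if L = {1..n} then 0 else c \<odot> s) (c \<odot> d)"
  using assms
  by (auto simp: dominates_def iscale_mono zero_le_iscale iscale_zero)

text \<open>
  The common part of the unary operations. \<open>F\<close> is the formula of the direct algorithm as a function of
  \<open>[\<lambda>\<^sub>i]\<close>, \<open>s1\<close> that of the sparse algorithm as a function of \<open>[\<mu>]\<close>, and \<open>s0\<close> the separate formula used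
  for an affine argument.
\<close>

lemma dominates_nonlinear:
  assumes dom: "dominates n L li di" and ok: "index_ok n I L"
    and linear: "s0 \<le> F 0"
    and nonlinear: "\<And>m. m \<le> di \<Longrightarrow> s1 m \<le> F di"
    and zero: "I \<noteq> {} \<Longrightarrow> 0 \<le> di \<Longrightarrow> 0 \<le> F di"
  shows "dominates n I (if L = {1..n} then s0 else s1 (mu I L li)) (F di)"
proof (rule dominatesI_proper)
  have sub: "I \<subseteq> L" and "I \<noteq> {1..n}"
    using ok by (auto simp: index_ok_def)
  then show "I \<noteq> {1..n}" by simp
  show "(if L = {1..n} then s0 else s1 (mu I L li)) \<le> F di"
  proof (cases "L = {1..n}")
    case True
    then have "di = 0" using dom by (simp add: dominates_def)
    then show ?thesis using linear True by simp
  next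
    case False
    have "mu I L li \<le> di"
      using dom sub False by (auto simp: mu_def dominates_def intro: hull0_le)
    then show ?thesis using nonlinear False by simp
  qed
  show "0 \<le> F di" if "I \<noteq> {}"
    using zero that dom sub by (auto simp: dominates_def)
qed

lemma irecip_bounds:
  assumes "0 \<notin> set_of A"
  shows "lower (irecip A) = 1 / upper A" "upper (irecip A) = 1 / lower A"
proof -
  have "lower A \<le> upper A" by simp
  moreover have "0 < lower A \<or> upper A < 0"
    using assms by (auto simp: in_interval_iff)
  ultimately have "1 / upper A \<le> 1 / lower A"
    by (auto simp: divide_simps)
  then show "lower (irecip A) = 1 / upper A" "upper (irecip A) = 1 / lower A"
    by (simp_all add: irecip_def)
qed

lemma inverse_in_irecip:
  assumes "0 \<notin> set_of A" "x \<in> set_of A"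
  shows "1 / x \<in> set_of (irecip A)"
proof -
  have "0 < lower A \<or> upper A < 0" "lower A \<le> x" "x \<le> upper A"
    using assms by (auto simp: in_interval_iff)
  then show ?thesis
    using assms by (auto simp: in_interval_iff irecip_bounds divide_simps)
qed

lemma power_in_ipow_2:
  assumes "x \<in> set_of A"
  shows "x\<^sup>2 \<in> set_of (ipow A 2)"
proof -
  have x: "lower A \<le> x" "x \<le> upper A" "lower A \<le> upper A"
    using assms by (simp_all add: in_interval_iff)
  have pos: "(lower A)\<^sup>2 \<le> x\<^sup>2" "x\<^sup>2 \<le> (upper A)\<^sup>2" "(lower A)\<^sup>2 \<le> (upper A)\<^sup>2" if "0 < lower A"
    using x that by (auto intro!: power_mono)
  have neg: "(upper A)\<^sup>2 \<le> x\<^sup>2" "x\<^sup>2 \<le> (lower A)\<^sup>2" "(upper A)\<^sup>2 \<le> (lower A)\<^sup>2" if "upper A < 0"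
    using x that power_mono[of "- upper A" "- x" 2] power_mono[of "- x" "- lower A" 2]
      power_mono[of "- upper A" "- lower A" 2] by auto
  show ?thesis
    using pos neg power2_le_sqmax[OF assms]
    by (auto simp: ipow_def in_interval_iff sqmax_def le_max_iff_disj)
qed

text \<open>
  For an affine argument the sparse algorithm contracts the coefficients of the direct formula into one
  power: \<open>2 y\<^sup>3\<close>, \<open>- 1 / y\<^sup>2\<close> and \<open>1 / (-4 y\<^sup>3)\<close>. Interval arithmetic treats repeated occurrences of
  \<open>y\<close> as independent, so each of these is included in the corresponding product, and by convexity only
  the two end points have to be checked. The present lemma and the next two do so.
\<close>

lemma ipow_3_le: "ipow A 3 \<le> ipow A 2 * A"
proof -
  have "(lower A) ^ 3 \<le> (upper A) ^ 3"
    by (intro power_mono_odd) auto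
  then have "lower (ipow A 3) = (lower A)\<^sup>2 * lower A" "upper (ipow A 3) = (upper A)\<^sup>2 * upper A"
    by (simp_all add: ipow_def power3_eq_cube power2_eq_square)
  then show ?thesis
    by (intro interval_leI_endpoints)
      (simp_all add: times_in_intervalI power_in_ipow_2 lower_in_interval upper_in_interval)
qed

lemma irecip_ipow_2_le:
  assumes "lower A > 0"
  shows "- irecip (ipow A 2) \<le> irecip A * - irecip A"
proof -
  have A0: "0 \<notin> set_of A" using assms by (auto simp: in_interval_iff)
  have "(lower A)\<^sup>2 \<le> (upper A)\<^sup>2"
    using assms by (intro power_mono) auto
  then have sq: "lower (ipow A 2) = (lower A)\<^sup>2" "upper (ipow A 2) = (upper A)\<^sup>2"
    using assms by (simp_all add: ipow_def)
  then have "0 \<notin> set_of (ipow A 2)"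
    using assms by (simp add: in_interval_iff not_le)
  note ends = irecip_bounds[OF this, unfolded sq]
  have mem: "- (1 / x\<^sup>2) \<in> set_of (irecip A * - irecip A)" if "x \<in> set_of A" for x
  proof -
    have "(1 / x) * - (1 / x) \<in> set_of (irecip A * - irecip A)"
      by (intro times_in_intervalI uminus_in_intervalI inverse_in_irecip A0 that)
    then show ?thesis by (simp add: power2_eq_square)
  qed
  show ?thesis
    by (intro interval_leI_endpoints) (simp_all add: ends mem lower_in_interval upper_in_interval)
qed

lemma irecip_isqrt_cube_le:
  assumes nonneg: "lower A \<ge> 0" and Y: "Y = isqrt A" and Y0: "0 \<notin> set_of Y"
  shows "irecip ((-4) \<odot> ipow Y 3) \<le> irecip (2 \<odot> Y) * irecip ((-2) \<odot> A)"
proof -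
  have "lower A \<le> upper A" by simp
  then have Yb: "lower Y = sqrt (lower A)" "upper Y = sqrt (upper A)"
    by (simp_all add: Y isqrt_def)
  then have pos: "0 < lower Y"
    using Y0 nonneg \<open>lower A \<le> upper A\<close> by (auto simp: in_interval_iff less_le)
  then have lu: "0 < upper Y" "lower Y ^ 3 \<le> upper Y ^ 3" "lower Y \<le> upper Y"
    using lower_le_upper[of Y] by (auto intro!: power_mono intro: less_le_trans simp del: lower_le_upper)
  have A: "lower A = (lower Y)\<^sup>2" "upper A = (upper Y)\<^sup>2"
    using nonneg \<open>lower A \<le> upper A\<close> order_trans[OF nonneg \<open>lower A \<le> upper A\<close>]
    by (simp_all add: Yb)
  let ?C = "(-4) \<odot> ipow Y 3"
  have C: "lower ?C = -4 * upper Y ^ 3" "upper ?C = -4 * lower Y ^ 3"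
    using lu by (simp_all add: iscale_def ipow_def)
  have C0: "0 \<notin> set_of ?C" using pos lu by (simp add: in_interval_iff C)
  have Y2: "lower (2 \<odot> Y) = 2 * lower Y" "upper (2 \<odot> Y) = 2 * upper Y"
    using lu by (simp_all add: iscale_def)
  have Y20: "0 \<notin> set_of (2 \<odot> Y)" using pos by (simp add: in_interval_iff Y2)
  have A2: "lower ((-2) \<odot> A) = -2 * upper A" "upper ((-2) \<odot> A) = -2 * lower A"
    using \<open>lower A \<le> upper A\<close> by (simp_all add: iscale_def)
  have A20: "0 \<notin> set_of ((-2) \<odot> A)" using pos by (simp add: in_interval_iff A2 A)
  have mem: "1 / (-4 * y ^ 3) \<in> set_of (irecip (2 \<odot> Y) * irecip ((-2) \<odot> A))"
    if "y = lower Y \<or> y = upper Y" for y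
  proof -
    have "2 * y \<in> set_of (2 \<odot> Y)" "-2 * y\<^sup>2 \<in> set_of ((-2) \<odot> A)"
      using that lu pos by (auto simp: in_interval_iff Y2 A2 A intro!: power_mono)
    then have "(1 / (2 * y)) * (1 / (-2 * y\<^sup>2)) \<in> set_of (irecip (2 \<odot> Y) * irecip ((-2) \<odot> A))"
      by (intro times_in_intervalI inverse_in_irecip Y20 A20)
    then show ?thesis by (simp add: power3_eq_cube power2_eq_square mult.assoc)
  qed
  show ?thesis
    by (intro interval_leI_endpoints) (simp_all only: irecip_bounds[OF C0] C mem simp_thms)
qed


section \<open>Recursion equations for the tables of a codelist\<close>

lemma run_initial: "k \<le> n \<Longrightarrow> run step n ops f k = f k"
  by (induction ops arbitrary: n f) auto

text \<open>
  A step sees the table computed up to then, but reads only entries below \<open>k\<close>, which no later step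
  changes. So the final table satisfies the recursion equations.
\<close>

lemma run_entry:
  assumes "\<And>k. k \<in> {n<..n + length ops} \<Longrightarrow> args_ok k (op_at n ops k)"
    and cong: "\<And>k p f g. args_ok k p \<Longrightarrow> (\<And>i. i \<in> {1..<k} \<Longrightarrow> f i = g i) \<Longrightarrow> step k p f = step k p g"
    and "k \<in> {n<..n + length ops}"
  shows "run step n ops f k = step k (op_at n ops k) (run step n ops f)"
  using assms(1,3)
proof (induction ops arbitrary: n f)
  case (Cons p ops)
  let ?f = "f(Suc n := step (Suc n) p f)"
  show ?case
  proof (cases "k = Suc n")
    case True
    have "args_ok (Suc n) p"
      using Cons.prems(1)[of "Suc n"] by (simp add: op_at_def)
    then have "step (Suc n) p f = step (Suc n) p (run step (Suc n) ops ?f)"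
      by (rule cong) (simp add: run_initial)
    then show ?thesis using True by (simp add: run_initial op_at_def)
  next
    case False
    have shift: "op_at n (p # ops) j = op_at (Suc n) ops j" if "j > Suc n" for j
      using that by (simp add: op_at_def nth_Cons')
    have "run step (Suc n) ops ?f k =
        step k (op_at (Suc n) ops k) (run step (Suc n) ops ?f)"
    proof (rule Cons.IH)
      show "args_ok j (op_at (Suc n) ops j)" if "j \<in> {Suc n<..Suc n + length ops}" for j
        using that Cons.prems(1)[of j] by (simp add: shift)
    qed (use False Cons.prems in auto)
    then show ?thesis using False Cons.prems by (simp add: shift)
  qed
qed simp

lemma ival_step_cong:
  "args_ok k p \<Longrightarrow> (\<And>i. i \<in> {1..<k} \<Longrightarrow> f i = g i) \<Longrightarrow> ival_step k p f = ival_step k p g"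
  by (cases p) auto

lemma grad_step_cong:
  "args_ok k p \<Longrightarrow> (\<And>i. i \<in> {1..<k} \<Longrightarrow> f i = g i) \<Longrightarrow> grad_step Y k p f = grad_step Y k p g"
  by (cases p) auto

lemma index_step_cong:
  "args_ok k p \<Longrightarrow> (\<And>i. i \<in> {1..<k} \<Longrightarrow> f i = g i) \<Longrightarrow> index_step k p f = index_step k p g"
  by (cases p) auto

lemma lamD_step_cong:
  "args_ok k p \<Longrightarrow> (\<And>i. i \<in> {1..<k} \<Longrightarrow> f i = g i) \<Longrightarrow>
    lamD_step n Y G k p f = lamD_step n Y G k p g"
  by (cases p) auto

lemma lamS_step_cong:
  "args_ok k p \<Longrightarrow> (\<And>i. i \<in> {1..<k} \<Longrightarrow> f i = g i) \<Longrightarrow>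
    lamS_step n Y G I L k p f = lamS_step n Y G I L k p g"
  by (cases p) (auto simp: Let_def)


section \<open>Comparison along a codelist\<close>

locale codelist =
  fixes n :: nat and ops :: "codeop list" and X :: "nat \<Rightarrow> real interval"
  assumes args: "k \<in> {n<..n + length ops} \<Longrightarrow> args_ok k (op_at n ops k)"
    and defined: "ivals_well_defined n X ops"
begin

abbreviation "Y \<equiv> ivals n X ops"
abbreviation "G \<equiv> igrads n X ops"
abbreviation "I \<equiv> I_set n ops"
abbreviation "L \<equiv> L_set n ops"
abbreviation "D \<equiv> lamD n X ops"
abbreviation "S \<equiv> lamS n X ops"

lemma table_entry:
  assumes "k \<in> {n<..n + length ops}"
  shows "Y k = ival_step k (op_at n ops k) Y"
    and "G k = grad_step Y k (op_at n ops k) G"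
    and "I k = fst (index_step k (op_at n ops k) (\<lambda>i. (I i, L i)))"
    and "L k = snd (index_step k (op_at n ops k) (\<lambda>i. (I i, L i)))"
    and "D k = lamD_step n Y G k (op_at n ops k) D"
    and "S k = lamS_step n Y G I L k (op_at n ops k) S"
proof -
  note run = run_entry[OF args _ assms]
  show "Y k = ival_step k (op_at n ops k) Y"
    unfolding ivals_def by (rule run) (auto intro: ival_step_cong)
  show "G k = grad_step Y k (op_at n ops k) G"
    unfolding igrads_def by (rule run) (auto intro: grad_step_cong)
  have "index_sets n ops k = index_step k (op_at n ops k) (index_sets n ops)"
    unfolding index_sets_def by (rule run) (auto intro: index_step_cong)
  then show "I k = fst (index_step k (op_at n ops k) (\<lambda>i. (I i, L i)))"
    and "L k = snd (index_step k (op_at n ops k) (\<lambda>i. (I i, L i)))"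
    by (simp_all add: I_set_def L_set_def)
  show "D k = lamD_step n Y G k (op_at n ops k) D"
    unfolding lamD_def by (rule run) (auto intro: lamD_step_cong)
  show "S k = lamS_step n Y G I L k (op_at n ops k) S"
    unfolding lamS_def by (rule run) (auto intro: lamS_step_cong)
qed

lemma table_initial:
  assumes "k \<le> n"
  shows "G k = (\<lambda>l. interval_of (if l = k then 1 else 0))"
    and "I k = {1..n} - {k}" "L k = {1..n}" "D k = 0" "S k = 0"
  using assms
  by (simp_all add: run_initial igrads_def I_set_def L_set_def index_sets_def lamD_def lamS_def)

lemma table_induct [consumes 1, case_names initial entry]:
  assumes "k \<in> {1..n + length ops}"
    and "\<And>k. k \<in> {1..n} \<Longrightarrow> P k"
    and "\<And>k. k \<in> {n<..n + length ops} \<Longrightarrow> args_ok k (op_at n ops k) \<Longrightarrow>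
           (\<And>i. i \<in> {1..<k} \<Longrightarrow> P i) \<Longrightarrow> P k"
  shows "P k"
  using assms(1)
proof (induction k rule: less_induct)
  case (less k)
  show ?case
  proof (cases "k \<le> n")
    case True
    then show ?thesis using less.prems assms(2) by simp
  next
    case False
    show ?thesis
    proof (rule assms(3))
      show k: "k \<in> {n<..n + length ops}" using False less.prems by simp
      then show "args_ok k (op_at n ops k)" by (rule args)
      show "P i" if "i \<in> {1..<k}" for i
        using that less.prems by (intro less.IH) auto
    qed
  qed
qed

lemma index_sets_ok:
  assumes "k \<in> {1..n + length ops}"
  shows "index_ok n (I k) (L k)"
  using assms
proof (induction k rule: table_induct)
  case (initial k)
  then have "I k = {1..n} - {k}" "L k = {1..n}"
    by (simp_all add: table_initial(2,3))
  then show ?case using initial unfolding index_ok_def by blast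
next
  case (entry k)
  have "index_ok n (I i) (L i) \<and> index_ok n (I i) (I i)" if "i \<in> {1..<k}" for i
    using entry(3)[OF that] index_ok_same by blast
  then show ?case
    using entry(2)
    by (cases "op_at n ops k") (simp_all add: table_entry(3,4)[OF entry(1)] index_ok_Int)
qed

text \<open>
  \<open>I k\<close> collects the variables that do not occur in the expression for \<open>y\<^sub>k\<close>, and every gradient rule is
  linear in the gradients of the arguments, so zero components persist exactly, without widening.
\<close>

lemma grads_vanish:
  assumes "k \<in> {1..n + length ops}" "l \<in> I k"
  shows "G k l = 0"
  using assms
proof (induction k rule: table_induct)
  case (initial k)
  then show ?case by (auto simp: table_initial interval_eq_iff)
next
  case (entry k)
  show ?case
    using entry(2-4)
    by (cases "op_at n ops k")
      (auto simp: table_entry(2,3)[OF entry(1)] iscale_eq_times)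
qed

text \<open>
  \<open>I i = L k\<close> is the situation of a nonlinear unary operation. A nonempty proper subset of \<open>{1..n}\<close>
  leaves no room for \<open>n = 1\<close>.
\<close>

lemma curvature_le:
  assumes "i \<in> {1..n + length ops}" "I i = L k"
  shows "Lam_s ({1..n} - L k) (G i) \<le> Lam_s {1..n} (G i)"
    and "L k \<noteq> {} \<Longrightarrow> 0 \<le> Lam_s {1..n} (G i)"
proof -
  have I: "I i \<subseteq> {1..n}" "I i \<noteq> {1..n}"
    using index_sets_ok[OF assms(1)] by (auto simp: index_ok_def)
  then show "Lam_s ({1..n} - L k) (G i) \<le> Lam_s {1..n} (G i)"
    using assms(2) by (intro Lam_s_mono) auto
  show "0 \<le> Lam_s {1..n} (G i)" if "L k \<noteq> {}"
  proof (rule zero_le_Lam_s)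
    have "0 < card (I i)" "card (I i) < card {1..n}"
      using that I assms(2) finite_subset[OF I(1)]
      by (auto simp: card_gt_0_iff intro!: psubset_card_mono simp del: card_atLeastAtMost)
    then show "card {1..n} \<noteq> 1" by linarith
  qed
qed

text \<open>
  The three facts about \<open>\<Lambda>\<^sub>t\<close> over \<open>{1..n}\<close> that \<open>dominates_mul\<close> needs. For the third, \<open>C\<^sub>\<star>\<close> leaves one
  coordinate \<open>p\<close> to the first gradient and another one \<open>q\<close> to the second.
\<close>

lemma mixed_term_le:
  assumes "i \<in> {1..n + length ops}" "j \<in> {1..n + length ops}"
  defines "T \<equiv> Lam_t {1..n} (G i) (G j)"
  shows "Lam_t ({1..n} - (I i \<inter> I j)) (G i) (G j) \<le> T"
    and "I i \<inter> I j \<noteq> {} \<Longrightarrow> 0 \<le> T"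
    and "C_star n (I i) (I j) \<Longrightarrow>
      gam = G i (the_elem ({1..n} - I i)) * G j (the_elem ({1..n} - I j)) \<Longrightarrow>
      Interval (- sqrt (sqmax gam), sqrt (sqmax gam)) \<le> T"
proof -
  have I: "I i \<subseteq> {1..n}" "I i \<noteq> {1..n}" "I j \<subseteq> {1..n}" "I j \<noteq> {1..n}"
    using index_sets_ok[OF assms(1)] index_sets_ok[OF assms(2)] unfolding index_ok_def by blast+
  note G = grads_vanish[OF assms(1)] grads_vanish[OF assms(2)]
  show "Lam_t ({1..n} - (I i \<inter> I j)) (G i) (G j) \<le> T"
    unfolding T_def
  proof (rule Lam_t_mono)
    show "G i l * G j l = 0" if "l \<in> {1..n} - ({1..n} - (I i \<inter> I j))" for l
      using that G(1)[of l] by simp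
  qed (use I in auto)
  have card_ne: "card {1..n} \<noteq> 1" if "J \<noteq> {}" "J \<subset> {1..n}" for J
  proof -
    have "finite J" using that by (meson finite_atLeastAtMost finite_subset psubset_imp_subset)
    then have "0 < card J" using that by (simp add: card_gt_0_iff)
    moreover have "card J < card {1..n}" using that by (intro psubset_card_mono) auto
    ultimately show ?thesis by linarith
  qed
  show "0 \<le> T" if "I i \<inter> I j \<noteq> {}"
    unfolding T_def using that I card_ne[of "I i \<inter> I j"] by (intro zero_le_Lam_t) auto
  assume star: "C_star n (I i) (I j)"
    and gam: "gam = G i (the_elem ({1..n} - I i)) * G j (the_elem ({1..n} - I j))"
  have singleton: "\<exists>p. {1..n} - J = {p}" if "card J = n - 1" "J \<subseteq> {1..n}" "J \<noteq> {1..n}" for J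
  proof -
    have "1 \<le> n" using that by (cases n) auto
    moreover have "finite J" using that by (meson finite_atLeastAtMost finite_subset)
    ultimately have "card ({1..n} - J) = 1" using that by (simp add: card_Diff_subset)
    then show ?thesis by (rule card_1_singletonE) blast
  qed
  obtain p q where pq: "{1..n} - I i = {p}" "{1..n} - I j = {q}"
    using star singleton[OF _ I(1,2)] singleton[OF _ I(3,4)] unfolding C_star_def by blast
  have "I i \<noteq> {}" using star I by (auto simp: C_star_def)
  then have "card {1..n} \<noteq> 1" using I by (intro card_ne[of "I i"]) auto
  moreover have "G i l * G j l = 0" if "l \<in> {1..n}" for l
  proof -
    have "l \<in> I i \<or> l \<in> I j" using star that unfolding C_star_def by blast
    then show ?thesis using G(1)[of l] G(2)[of l] by auto
  qed
  moreover have "p \<in> {1..n}" "q \<in> {1..n}" using pq by blast+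
  ultimately show "Interval (- sqrt (sqmax gam), sqrt (sqmax gam)) \<le> T"
    unfolding T_def gam pq the_elem_eq by (intro symmetric_interval_le_Lam_t finite_atLeastAtMost)
qed

text \<open>
  For a nonlinear unary operation there are two things to check beside monotonicity of interval
  operations: the separate formula for an affine argument, and that the direct formula keeps \<open>0\<close>.
\<close>

lemma lamS_dominated:
  assumes "k \<in> {1..n + length ops}"
  shows "dominates n (L k) (S k) (D k)"
  using assms
proof (induction k rule: table_induct)
  case (initial k)
  then show ?case by (simp add: table_initial dominates_def)
next
  case (entry k)
  note eqs = table_entry(4-6)[OF entry(1)]
  have Y: "ival_op_defined k (op_at n ops k) Y"
    using defined entry(1) by (auto simp: ivals_well_defined_def)
  have dom: "dominates n (L i) (S i) (D i)" and ok: "index_ok n (I i) (L i)"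
    and range: "i \<in> {1..n + length ops}" if "i \<in> {1..<k}" for i
    using that entry(1) by (auto intro: entry(3) index_sets_ok)
  note mono = add_mono interval_times_mono interval_minus_mono iscale_mono
  note zero = add_nonneg_nonneg zero_le_times_interval zero_le_minus_interval zero_le_iscale
  show ?case
  proof (cases "op_at n ops k")
    case (OpAdd i j)
    then have ij: "i \<in> {1..<k}" "j \<in> {1..<k}" using entry(2) by auto
    have "L i \<subseteq> {1..n}" "L j \<subseteq> {1..n}"
      using ok[OF ij(1)] ok[OF ij(2)] unfolding index_ok_def by blast+
    then show ?thesis
      using dominates_add[OF dom[OF ij(1)] dom[OF ij(2)]] by (simp add: eqs OpAdd)
  next
    case (OpMul i j)
    then have ij: "i \<in> {1..<k}" "j \<in> {1..<k}" using entry(2) by auto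
    have Lk: "L k = I i \<inter> I j" using OpMul by (simp add: eqs)
    have "dominates n (I i \<inter> I j) (S k) (D k)"
      unfolding eqs(2,3) OpMul lamS_step.simps lamD_step.simps Lk
      by (intro dominates_mul dom ok ij mixed_term_le range refl)
    then show ?thesis by (simp add: Lk)
  next
    case (OpPowNat i m)
    then have i: "i \<in> {1..<k}" using entry(2) by auto
    have Lk: "L k = I i" using OpPowNat by (simp add: eqs)
    note curv = curvature_le[OF range[OF i] Lk[symmetric], unfolded Lk]
    let ?s = "Lam_s ({1..n} - I i) (G i)" and ?d = "Lam_s {1..n} (G i)"
    have "dominates n (I i) (S k) (D k)"
      unfolding eqs(2,3) OpPowNat lamS_step.simps lamD_step.simps Let_def Lk
    proof (rule dominates_nonlinear[OF dom[OF i] ok[OF i],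
          where F = "\<lambda>x. (real m \<odot> ipow (Y i) (m - 2)) * ((real m - 1) \<odot> ?d + Y i * x)"
          and ?s1.0 = "\<lambda>u. (real m \<odot> ipow (Y i) (m - 2)) * ((real m - 1) \<odot> ?s + Y i * u)"])
      have "((real m * (real m - 1)) \<odot> ipow (Y i) (m - 2)) * ?s =
          (real m \<odot> ipow (Y i) (m - 2)) * ((real m - 1) \<odot> ?s)"
        by (simp add: iscale_eq_times interval_of_mult[symmetric] interval_mult_ac)
      also have "\<dots> \<le> (real m \<odot> ipow (Y i) (m - 2)) * ((real m - 1) \<odot> ?d + Y i * 0)"
        using curv(1) by (auto simp: iscale_eq_times intro: interval_times_mono)
      finally show "((real m * (real m - 1)) \<odot> ipow (Y i) (m - 2)) * ?s \<le> \<dots>" .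
    qed (intro mono zero order_refl curv; assumption)+
    then show ?thesis by (simp add: Lk)
  next
    case (OpOneOver i)
    then have i: "i \<in> {1..<k}" using entry(2) by auto
    have Lk: "L k = I i" using OpOneOver by (simp add: eqs)
    note curv = curvature_le[OF range[OF i] Lk[symmetric], unfolded Lk]
    let ?s = "Lam_s ({1..n} - I i) (G i)" and ?d = "Lam_s {1..n} (G i)"
    have "dominates n (I i) (S k) (D k)"
      unfolding eqs(2,3) OpOneOver lamS_step.simps lamD_step.simps Let_def Lk
    proof (rule dominates_nonlinear[OF dom[OF i] ok[OF i],
          where F = "\<lambda>x. ipow (Y k) 2 * ((2 \<odot> Y k) * ?d - x)"
          and ?s1.0 = "\<lambda>m. ipow (Y k) 2 * ((2 \<odot> Y k) * ?s - m)"])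
      have "(2 \<odot> ipow (Y k) 3) * ?s \<le> (2 \<odot> (ipow (Y k) 2 * Y k)) * ?d"
        unfolding iscale_eq_times by (intro mono order_refl ipow_3_le curv)
      also have "\<dots> = ipow (Y k) 2 * ((2 \<odot> Y k) * ?d - 0)"
        by (simp add: iscale_eq_times interval_minus_zero interval_mult_ac)
      finally show "(2 \<odot> ipow (Y k) 3) * ?s \<le> \<dots>" .
    qed (intro mono zero order_refl curv; assumption)+
    then show ?thesis by (simp add: Lk)
  next
    case (OpSqrt i)
    then have i: "i \<in> {1..<k}" using entry(2) by auto
    have Lk: "L k = I i" using OpSqrt by (simp add: eqs)
    note curv = curvature_le[OF range[OF i] Lk[symmetric], unfolded Lk]
    let ?s = "Lam_s ({1..n} - I i) (G i)" and ?d = "Lam_s {1..n} (G i)"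
    have recip: "irecip ((-4) \<odot> ipow (Y k) 3) \<le> irecip (2 \<odot> Y k) * irecip ((-2) \<odot> Y i)"
      using Y OpSqrt table_entry(1)[OF entry(1)] by (intro irecip_isqrt_cube_le) auto
    have "dominates n (I i) (S k) (D k)"
      unfolding eqs(2,3) OpSqrt lamS_step.simps lamD_step.simps Let_def Lk
    proof (rule dominates_nonlinear[OF dom[OF i] ok[OF i],
          where F = "\<lambda>x. irecip (2 \<odot> Y k) * (x + irecip ((-2) \<odot> Y i) * ?d)"
          and ?s1.0 = "\<lambda>m. irecip (2 \<odot> Y k) * (irecip ((-2) \<odot> Y i) * ?s + m)"])
      show "irecip ((-4) \<odot> ipow (Y k) 3) * ?s \<le>
          irecip (2 \<odot> Y k) * (0 + irecip ((-2) \<odot> Y i) * ?d)"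
        using interval_times_mono[OF recip curv(1)] by (simp add: mult.assoc)
      show "irecip (2 \<odot> Y k) * (irecip ((-2) \<odot> Y i) * ?s + m) \<le>
          irecip (2 \<odot> Y k) * (D i + irecip ((-2) \<odot> Y i) * ?d)" if "m \<le> D i" for m
        unfolding add.commute[of "D i"] by (intro mono order_refl curv that)
    qed (intro mono zero order_refl curv; assumption)+
    then show ?thesis by (simp add: Lk)
  next
    case (OpExp i)
    then have i: "i \<in> {1..<k}" using entry(2) by auto
    have Lk: "L k = I i" using OpExp by (simp add: eqs)
    note curv = curvature_le[OF range[OF i] Lk[symmetric], unfolded Lk]
    let ?s = "Lam_s ({1..n} - I i) (G i)" and ?d = "Lam_s {1..n} (G i)"
    have "dominates n (I i) (S k) (D k)"
      unfolding eqs(2,3) OpExp lamS_step.simps lamD_step.simps Let_def Lk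
    proof (rule dominates_nonlinear[OF dom[OF i] ok[OF i],
          where F = "\<lambda>x. Y k * (?d + x)"
          and ?s1.0 = "\<lambda>m. Y k * (?s + m)"])
      show "Y k * ?s \<le> Y k * (?d + 0)"
        using curv(1) by (simp add: interval_times_mono)
    qed (intro mono zero order_refl curv; assumption)+
    then show ?thesis by (simp add: Lk)
  next
    case (OpLn i)
    then have i: "i \<in> {1..<k}" using entry(2) by auto
    have Lk: "L k = I i" using OpLn by (simp add: eqs)
    note curv = curvature_le[OF range[OF i] Lk[symmetric], unfolded Lk]
    let ?s = "Lam_s ({1..n} - I i) (G i)" and ?d = "Lam_s {1..n} (G i)"
    have recip: "- irecip (ipow (Y i) 2) \<le> irecip (Y i) * - irecip (Y i)"
      using Y OpLn by (intro irecip_ipow_2_le) auto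
    have "dominates n (I i) (S k) (D k)"
      unfolding eqs(2,3) OpLn lamS_step.simps lamD_step.simps Let_def Lk
    proof (rule dominates_nonlinear[OF dom[OF i] ok[OF i],
          where F = "\<lambda>x. irecip (Y i) * (x - irecip (Y i) * ?d)"
          and ?s1.0 = "\<lambda>m. irecip (Y i) * (m - irecip (Y i) * ?s)"])
      have "(- irecip (ipow (Y i) 2)) * ?s \<le> (irecip (Y i) * - irecip (Y i)) * ?d"
        by (intro mono recip curv)
      also have "\<dots> = irecip (Y i) * (0 - irecip (Y i) * ?d)"
        by (simp add: minus_interval_def uminus_eq_times mult.assoc)
      finally show "(- irecip (ipow (Y i) 2)) * ?s \<le> \<dots>" .
    qed (intro mono zero order_refl curv; assumption)+
    then show ?thesis by (simp add: Lk)
  next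
    case (OpAddC i c)
    then show ?thesis
      using entry(2) dom[of i] by (auto simp: eqs dominates_def)
  next
    case (OpMulByC c i)
    then have i: "i \<in> {1..<k}" using entry(2) by auto
    then show ?thesis
      using dominates_scale[OF dom[OF i], of c] by (simp add: eqs OpMulByC)
  qed
qed

end

theorem proposition4p18:
  fixes \<phi> :: "real^'n \<Rightarrow> real"
    and U :: "(real^'n) set"
    and e :: "nat \<Rightarrow> 'n"
    and ops :: "codeop list"
    and X :: "nat \<Rightarrow> real interval"
  assumes "bij_betw e {1..CARD('n)} UNIV"
    and "open U"
    and "C2_on \<phi> U"
    and "is_codelist e ops U \<phi>"
    and "{x. \<forall>k\<in>{1..CARD('n)}. x $ e k \<in> set_of (X k)} \<subseteq> U"
    and "ivals_well_defined CARD('n) X ops"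
  shows "set_of (algorithm_S CARD('n) X ops) \<subseteq> set_of (algorithm_D CARD('n) X ops)"
proof -
  interpret codelist "CARD('n)" ops X
    using assms(4,6) by unfold_locales (auto simp: is_codelist_def)
  let ?K = "CARD('n) + length ops"
  have "dominates CARD('n) (L ?K) (S ?K) (D ?K)"
    by (rule lamS_dominated) (simp add: Suc_le_eq)
  moreover have "{} \<noteq> {1..CARD('n)}"
    by (auto simp: Suc_le_eq)
  ultimately have "algorithm_S CARD('n) X ops \<le> algorithm_D CARD('n) X ops"
    by (auto simp: algorithm_S_def algorithm_D_def Let_def dominates_def intro: hull0_le)
  then show ?thesis
    by (simp add: interval_le_iff_subset)
qed

end
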